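(* Let $1\le m<n$ and let $L=L(p)$ be a conical tropical linear space, where $p\in\mathbb{T}^{\binom{[n]}{m}}$ is a tropical Plücker vector of rank $m$. Then $L$ satisfies the $f$-vector conjecture: for every $1\le i\le m$, the polyhedral complex $L\cap\mathbb{R}^n$ has at most \[ \binom{n-i-1}{i-1}\binom{n-2i}{m-i} \] faces of dimension $i$ that become bounded after modding out by the lineality space generated by the vector $(1,\dots,1)\in\mathbb{R}^n$.
   Context: Notation: $[n]=\{1,\dots,n\}$; $\binom{[n]}{m}$ is the set of $m$-element subsets of $[n]$; $\mathbb{T}=\mathbb{R}\cup\{\infty\}$; $S\cup i$, $S-i$ mean $S\cup\{i\}$, $S\setminus\{i\}$; $e_S=\sum_{i\in S}e_i$. $\binom{N}{k}=0$ if $N\ge0$ and $k<0$ or $k>N$ (if $n-2i<0$ the stated product is $0$ since its first factor is). Tropical Plücker vector of rank $m$: a vector $p\in\mathbb{T}^{\binom{[n]}{m}}$, not identically $\infty$, such that for all $S,T\subseteq[n]$ with $|S|=m-1$, $|T|=m+1$, the minimum $\min_{i\in T\setminus S}(p_{S\cup i}+p_{T-i})$ is achieved for at least two values of $i$ or equals $\infty$. Its support $\{A:p_A\ne\infty\}$ is the set of bases of a matroid $M$ on $[n]$, the underlying matroid of $p$. For $S\subseteq[n]$ with $|S|=m+1$ let $c_S\in\mathbb{T}^n$ be given by $(c_S)_i=p_{S-i}$ if $i\in S$, $\infty$ otherwise. The circuits of $p$ are the vectors $c_S+\lambda(1,\dots,1)$, $\lambda\in\mathbb{R}$, with $c_S\ne(\infty,\dots,\infty)$.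 Vectors $x,y\in\mathbb{T}^n$ are tropically orthogonal if $\min_i(x_i+y_i)$ is achieved at least twice or equals $\infty$. The tropical linear space $L(p)\subseteq\mathbb{T}^n$ is the set of vectors tropically orthogonal to all circuits of $p$. For a basis $A$ of $M$ and $v\in\mathbb{R}^n$, let $w_p(v,A)=-p_A+\sum_{i\in A}v_i$. The bases of $M$ maximizing $w_p(v,\cdot)$ are the bases of a matroid $M_v$. With $\Gamma(N)=\mathrm{conv}\{e_A: A\text{ a basis of }N\}$ for a matroid $N$, the regular subdivision $\mathcal{D}_p$ of $\Gamma(M)$ induced by $p$ is the subdivision whose faces are the polytopes $\Gamma(M_v)$, $v\in\mathbb{R}^n$. The set $L(p)\cap\mathbb{R}^n$ is a polyhedral complex whose faces are the closures of the sets $\{v'\in L(p)\cap\mathbb{R}^n: M_{v'}=M_v\}$, $v\in L(p)\cap\mathbb{R}^n$. Every face is invariant under translation by $\mathbb{R}(1,\dots,1)$; it "becomes bounded" if its image in $\mathbb{R}^n/\mathbb{R}(1,\dots,1)$ is bounded. Dimensions are taken in $\mathbb{R}^n$. Conical: for $B\in\binom{[n]}{m}$ and a matrix $V\in\mathbb{T}^{B\times([n]\setminus B)}$, let $\bar V\in\mathbb{T}^{B\times[n]}$ be the augmented matrix whose columns indexed by $[n]\setminus B$ form $V$ and whose columns indexed by $B$ form the tropical identity matrix ($\bar V_{b,b}=0$, and $\bar V_{b,b'}=\infty$ for $b\neq b'$ in $B$). Define $\tau_V\in\mathbb{T}^{\binom{[n]}{m}}$ by the tropical maximal minors $(\tau_V)_A=\min_{\sigma}\sum_{a\in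 A}\bar V_{\sigma(a),a}$, the minimum over all bijections $\sigma:A\to B$. This is a tropical Plücker vector. A conical matroid subdivision is a subdivision of the form $\mathcal{D}_{\tau_V}$ for some such $B$ and $V$. The tropical linear space $L(p)$ is conical if $\mathcal{D}_p$ is a conical matroid subdivision. *)

theory Defs
  imports "HOL-Analysis.Analysis"
begin

text \<open>
  The ground set \<open>[n]\<close> is a finite type \<open>'n\<close> with \<open>n\<close> elements, so that \<open>\<real>\<^sup>n\<close> is \<^typ>\<open>real ^ 'n\<close>.
  Tropical numbers \<open>\<real> \<union> {\<infinity>}\<close> are the extended reals other than \<open>-\<infinity>\<close>; the value \<open>-\<infinity>\<close> is
  excluded explicitly wherever tropical data is introduced.  A vector indexed by the
  \<open>m\<close>-element subsets of \<open>[n]\<close> is a function on all subsets whose values on sets of any other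
  cardinality are never used.  A matroid on \<open>[n]\<close> is represented by its set of bases.
\<close>

text \<open>The minimum over the finite index set \<open>I\<close> is attained at least twice or is \<open>\<infinity>\<close>.\<close>

definition min_attained_twice :: "'i set \<Rightarrow> ('i \<Rightarrow> ereal) \<Rightarrow> bool" where
  "min_attained_twice I f \<longleftrightarrow>
     (INF i\<in>I. f i) = \<infinity> \<or>
     (\<exists>i\<in>I. \<exists>j\<in>I. i \<noteq> j \<and> f i = (INF k\<in>I. f k) \<and> f j = (INF k\<in>I. f k))"

definition tropical_pluecker :: "nat \<Rightarrow> ('n::finite set \<Rightarrow> ereal) \<Rightarrow> bool" where
  "tropical_pluecker m p \<longleftrightarrow>
     (\<forall>A. card A = m \<longrightarrow> p A \<noteq> -\<infinity>) \<and>
     (\<exists>A. card A = m \<and> p A \<noteq> \<infinity>) \<and>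
     (\<forall>S T. card S + 1 = m \<longrightarrow> card T = m + 1 \<longrightarrow>
        min_attained_twice (T - S) (\<lambda>i. p (insert i S) + p (T - {i})))"

definition matroid_bases :: "nat \<Rightarrow> ('n::finite set \<Rightarrow> ereal) \<Rightarrow> 'n set set" where
  "matroid_bases m p = {A. card A = m \<and> p A \<noteq> \<infinity>}"

definition circuit_vector :: "('n::finite set \<Rightarrow> ereal) \<Rightarrow> 'n set \<Rightarrow> ereal ^ 'n" where
  "circuit_vector p S = (\<chi> i. if i \<in> S then p (S - {i}) else \<infinity>)"

definition circuits :: "nat \<Rightarrow> ('n::finite set \<Rightarrow> ereal) \<Rightarrow> (ereal ^ 'n) set" where
  "circuits m p =
     {(\<chi> i. circuit_vector p S $ i + ereal c) | S c.
        card S = m + 1 \<and> circuit_vector p S \<noteq> (\<chi> i. \<infinity>)}"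

definition tropically_orthogonal :: "ereal ^ 'n::finite \<Rightarrow> ereal ^ 'n \<Rightarrow> bool" where
  "tropically_orthogonal x y \<longleftrightarrow> min_attained_twice UNIV (\<lambda>i. x $ i + y $ i)"

definition tropical_linear_space :: "nat \<Rightarrow> ('n::finite set \<Rightarrow> ereal) \<Rightarrow> (ereal ^ 'n) set" where
  "tropical_linear_space m p =
     {x. (\<forall>i. x $ i \<noteq> -\<infinity>) \<and> (\<forall>c\<in>circuits m p. tropically_orthogonal x c)}"

text \<open>The set \<open>L(p) \<inter> \<real>\<^sup>n\<close>.\<close>

definition real_part :: "nat \<Rightarrow> ('n::finite set \<Rightarrow> ereal) \<Rightarrow> (real ^ 'n) set" where
  "real_part m p = {v. (\<chi> i. ereal (v $ i)) \<in> tropical_linear_space m p}"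

text \<open>Only evaluated at bases \<open>A\<close>, where \<open>p A\<close> is finite.\<close>

definition basis_weight :: "('n::finite set \<Rightarrow> ereal) \<Rightarrow> real ^ 'n \<Rightarrow> 'n set \<Rightarrow> real" where
  "basis_weight p v A = - real_of_ereal (p A) + (\<Sum>i\<in>A. v $ i)"

text \<open>The bases of the matroid \<open>M\<^sub>v\<close>.\<close>

definition initial_bases :: "nat \<Rightarrow> ('n::finite set \<Rightarrow> ereal) \<Rightarrow> real ^ 'n \<Rightarrow> 'n set set" where
  "initial_bases m p v =
     {A \<in> matroid_bases m p. \<forall>B\<in>matroid_bases m p. basis_weight p v B \<le> basis_weight p v A}"

definition matroid_polytope :: "'n::finite set set \<Rightarrow> (real ^ 'n) set" where
  "matroid_polytope \<B> = convex hull ((\<lambda>A. \<Sum>i\<in>A. axis i 1) ` \<B>)"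

text \<open>A subdivision is represented by its set of faces.\<close>

definition regular_subdivision :: "nat \<Rightarrow> ('n::finite set \<Rightarrow> ereal) \<Rightarrow> (real ^ 'n) set set" where
  "regular_subdivision m p = range (\<lambda>v. matroid_polytope (initial_bases m p v))"

text \<open>
  A matrix is given by its entry in row \<open>b\<close> and column \<open>a\<close>; of \<open>V\<close> only the entries with
  \<open>b \<in> B\<close> and \<open>a \<notin> B\<close> are used.
\<close>

definition augmented_matrix :: "'n set \<Rightarrow> ('n \<Rightarrow> 'n \<Rightarrow> ereal) \<Rightarrow> 'n \<Rightarrow> 'n \<Rightarrow> ereal" where
  "augmented_matrix B V b a = (if a \<in> B then (if b = a then 0 else \<infinity>) else V b a)"

definition tropical_minors :: "'n::finite set \<Rightarrow> ('n \<Rightarrow> 'n \<Rightarrow> ereal) \<Rightarrow> 'n set \<Rightarrow> ereal" where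
  "tropical_minors B V A =
     (INF \<sigma>\<in>{\<sigma>. bij_betw \<sigma> A B}. \<Sum>a\<in>A. augmented_matrix B V (\<sigma> a) a)"

definition conical_subdivision :: "nat \<Rightarrow> (real ^ 'n::finite) set set \<Rightarrow> bool" where
  "conical_subdivision m \<D> \<longleftrightarrow>
     (\<exists>B V. card B = m \<and> (\<forall>b\<in>B. \<forall>a\<in>-B. V b a \<noteq> -\<infinity>) \<and>
        \<D> = regular_subdivision m (tropical_minors B V))"

definition conical :: "nat \<Rightarrow> ('n::finite set \<Rightarrow> ereal) \<Rightarrow> bool" where
  "conical m p \<longleftrightarrow> conical_subdivision m (regular_subdivision m p)"

text \<open>The faces of the polyhedral complex \<open>L(p) \<inter> \<real>\<^sup>n\<close>.\<close>

definition tls_faces :: "nat \<Rightarrow> ('n::finite set \<Rightarrow> ereal) \<Rightarrow> (real ^ 'n) set set" where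
  "tls_faces m p =
     (\<lambda>v. closure {v' \<in> real_part m p. initial_bases m p v' = initial_bases m p v})
       ` real_part m p"

text \<open>
  Boundedness of the image of \<open>F\<close> in \<open>\<real>\<^sup>n/\<real>(1,\<dots>,1)\<close>: the quotient norm of the class of \<open>x\<close> is
  the distance of \<open>x\<close> from the line \<open>\<real>(1,\<dots>,1)\<close>.  (\<open>1\<close> is the all-ones vector.)
\<close>

definition bounded_mod_lineality :: "(real ^ 'n::finite) set \<Rightarrow> bool" where
  "bounded_mod_lineality F \<longleftrightarrow> bounded ((\<lambda>x. infdist x (span {1})) ` F)"

definition bounded_faces :: "nat \<Rightarrow> ('n::finite set \<Rightarrow> ereal) \<Rightarrow> nat \<Rightarrow> (real ^ 'n) set set" where
  "bounded_faces m p i = {F \<in> tls_faces m p. aff_dim F = int i \<and> bounded_mod_lineality F}"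

end

theory Submission
  imports Defs
begin

text \<open>
  Every face of \<open>L(p) \<inter> \<real>\<^sup>n\<close> is the closure of an open cell \<open>{v. M\<^sub>v = \<N>}\<close>, so the bounded faces of
  dimension \<open>i\<close> are counted by counting the possible base sets \<open>\<N>\<close>.  Such an \<open>\<N>\<close> has no loop, because
  \<open>v \<in> L(p)\<close> (\<open>real_part_iff_loopless\<close>), and no coloop \<open>k\<close>, because the cell would otherwise contain
  a ray in direction \<open>e\<^sub>k\<close> (\<open>bounded_cell_coloopless\<close>); and \<open>i\<close> is the dimension of the space of
  those \<open>u\<close> for which \<open>\<Sum>\<^sub>k\<^sub>\<in>\<^sub>A u\<^sub>k\<close> is the same for all \<open>A \<in> \<N>\<close> (\<open>aff_dim_open_cell\<close>).  All three
  properties are intrinsic to \<open>\<N>\<close>, and \<open>\<N>\<close> can be read off from its polytope.  Equality of the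
  subdivisions \<open>\<D>\<^sub>p\<close> and \<open>\<D>\<^sub>\<tau>\<close> for the tropical minors \<open>\<tau>\<close> of \<open>V\<close> therefore gives \<open>\<N> = M\<^sub>w\<close> for some \<open>w\<close>, with
  \<open>M\<^sub>w\<close> now formed with respect to \<open>\<tau>\<close>.

  The bases of \<open>M\<^sub>w\<close> are the column sets of minimum-cost matchings of the rows \<open>B\<close> into the columns.  Since
  every column is avoided by some optimal matching, an exchange argument shows that optimal matchings
  use an entry of least reduced cost \<open>V\<^sub>b\<^sub>a - w\<^sub>a\<close> in every row (\<open>optimal_row_minimal\<close>); and since no
  column in \<open>B\<close> is a loop, the identity matching is optimal.  So \<open>\<N>\<close>
  consists of the transversals of the bipartite graph \<open>G = {(b, a). w\<^sub>a - w\<^sub>b = V\<^sub>b\<^sub>a}\<close> between \<open>B\<close> and its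
  complement, \<open>w\<close> satisfies \<open>w\<^sub>a - w\<^sub>b \<le> V\<^sub>b\<^sub>a\<close> throughout, \<open>G\<close> has no isolated vertex and \<open>i\<close> connected
  components (\<open>initial_transversals\<close>).  It remains to count such tight graphs.

  Infinite entries may be replaced by large finite ones, and a small perturbation of \<open>V\<close> in a suitable direction
  replaces distinct tight graphs by distinct tight forests with the same components as the graphs (\<open>cell_count\<close>).
  For a generic finite matrix fix a root \<open>a\<^sub>0 \<notin> B\<close>.  The tight forest \<open>F\<close> describes a
  cell that is bounded after fixing the coordinate \<open>a\<^sub>0\<close>; at the point of the closed cell with the largest
  coordinates the tight graph is a spanning tree \<open>T \<supseteq> F\<close>, and the \<open>i - 1\<close> edges in \<open>T - F\<close> point away from
  the root, from \<open>B\<close> to distinct right vertices \<open>R\<close> (\<open>maximal_point_tree\<close>).  Then \<open>F\<close> is determined by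
  the set \<open>R\<close> and by its own degrees at the right vertices: together they give the right
  degrees of \<open>T\<close>, these determine \<open>T\<close> (\<open>tight_tree_unique\<close>), and the removed edges are the edges of
  \<open>T\<close> that enter \<open>R\<close> from the root.  There are \<open>(n - m - 1) choose (i - 1)\<close> sets \<open>R\<close>; the degrees, each
  decreased by one, form a weak composition of \<open>m - i\<close> into \<open>n - m\<close> parts, of which there are
  \<open>(n - i - 1) choose (m - i)\<close>.  The product of the two numbers is the asserted bound
  (\<open>multinomial_two_factorizations\<close>).
\<close>

section \<open>Cells of a tropical linear space\<close>

text \<open>
  The linear functionals that are constant on the polytope of \<open>\<N>\<close>.  For a matroid they are spanned
  by the indicator vectors of the connected components, so the dimension is the number of components.
\<close>

definition sum_constant_space :: "'n::finite set set \<Rightarrow> (real ^ 'n) set" where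
  "sum_constant_space \<N> = {u. \<forall>A\<in>\<N>. \<forall>A'\<in>\<N>. (\<Sum>k\<in>A. u $ k) = (\<Sum>k\<in>A'. u $ k)}"

lemma min_attained_twice_iff:
  assumes "finite I"
  shows "min_attained_twice I f \<longleftrightarrow>
    (\<forall>i\<in>I. f i = \<infinity>) \<or> (\<exists>i\<in>I. \<exists>j\<in>I. i \<noteq> j \<and> f j = f i \<and> (\<forall>k\<in>I. f i \<le> f k))"
proof -
  have "(INF k\<in>I. f k) = \<infinity> \<longleftrightarrow> (\<forall>i\<in>I. f i = \<infinity>)"
    using INF_top_conv(1)[of f I] by (simp add: top_ereal_def)
  moreover have inf: "f i = (INF k\<in>I. f k) \<longleftrightarrow> (\<forall>k\<in>I. f i \<le> f k)" if "i \<in> I" for i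
    using that by (metis INF_greatest INF_lower order.antisym)
  moreover have "(\<exists>i\<in>I. \<exists>j\<in>I. i \<noteq> j \<and> f i = (INF k\<in>I. f k) \<and> f j = (INF k\<in>I. f k)) \<longleftrightarrow>
      (\<exists>i\<in>I. \<exists>j\<in>I. i \<noteq> j \<and> f j = f i \<and> (\<forall>k\<in>I. f i \<le> f k))"
    by (intro bex_cong refl) (metis inf)
  ultimately show ?thesis unfolding min_attained_twice_def by simp
qed

lemma finite_on_bases:
  assumes "tropical_pluecker m p" "A \<in> matroid_bases m p"
  shows "\<exists>r. p A = ereal r"
  using assms by (cases "p A") (auto simp: tropical_pluecker_def matroid_bases_def)

text \<open>
  On \<open>S\<close> the terms \<open>v\<^sub>i + p(S - i)\<close> of the circuit condition differ from the negated weights of the bases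
  \<open>S - i\<close> by the constant \<open>\<Sum>\<^sub>k\<^sub>\<in>\<^sub>S v\<^sub>k\<close>.  A minimum attained twice is thus a maximal weight attained twice.
\<close>

lemma real_part_iff_weights:
  fixes p :: "'n::finite set \<Rightarrow> ereal"
  assumes p: "tropical_pluecker m p"
  shows "v \<in> real_part m p \<longleftrightarrow>
    (\<forall>S. card S = m + 1 \<longrightarrow> (\<exists>i\<in>S. S - {i} \<in> matroid_bases m p) \<longrightarrow>
      (\<exists>i\<in>S. \<exists>j\<in>S. i \<noteq> j \<and> S - {i} \<in> matroid_bases m p \<and> S - {j} \<in> matroid_bases m p \<and>
        basis_weight p v (S - {j}) = basis_weight p v (S - {i}) \<and>
        (\<forall>k\<in>S. S - {k} \<in> matroid_bases m p \<longrightarrow> basis_weight p v (S - {k}) \<le> basis_weight p v (S - {i}))))"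
    (is "_ \<longleftrightarrow> (\<forall>S. card S = m + 1 \<longrightarrow> ?base S \<longrightarrow> ?twice S)")
proof -
  let ?\<M> = "matroid_bases m p"
  have val: "ereal (v $ i) + (circuit_vector p S $ i + ereal c) =
      (if i \<in> S \<and> S - {i} \<in> ?\<M> then ereal ((\<Sum>k\<in>S. v $ k) + c - basis_weight p v (S - {i})) else \<infinity>)"
    if S: "card S = m + 1" for S i c
  proof (cases "i \<in> S \<and> S - {i} \<in> ?\<M>")
    case True
    then obtain r where r: "p (S - {i}) = ereal r" using finite_on_bases[OF p] by blast
    have "(\<Sum>k\<in>S. v $ k) = v $ i + (\<Sum>k\<in>S - {i}. v $ k)" using True by (simp add: sum.remove)
    then show ?thesis using True r by (simp add: circuit_vector_def basis_weight_def)
  next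
    case False
    then have "circuit_vector p S $ i = \<infinity>" using S by (auto simp: circuit_vector_def matroid_bases_def)
    then show ?thesis unfolding if_not_P[OF False] by simp
  qed
  have ne: "circuit_vector p S \<noteq> (\<chi> i. \<infinity>) \<longleftrightarrow> ?base S" if S: "card S = m + 1" for S
    using S by (auto simp: circuit_vector_def matroid_bases_def vec_eq_iff)
  have orth: "tropically_orthogonal (\<chi> i. ereal (v $ i)) (\<chi> i. circuit_vector p S $ i + ereal c) \<longleftrightarrow> ?twice S"
    if S: "card S = m + 1" "?base S" for S c
  proof -
    define f where "f i = (if i \<in> S \<and> S - {i} \<in> ?\<M>
      then ereal ((\<Sum>k\<in>S. v $ k) + c - basis_weight p v (S - {i})) else \<infinity>)" for i
    have fin: "f i \<noteq> \<infinity> \<longleftrightarrow> i \<in> S \<and> S - {i} \<in> ?\<M>" for i by (simp add: f_def)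
    have fval: "f i = ereal ((\<Sum>k\<in>S. v $ k) + c - basis_weight p v (S - {i}))"
      if "i \<in> S" "S - {i} \<in> ?\<M>" for i using that by (simp add: f_def)
    have ex: "\<not> (\<forall>i. f i = \<infinity>)" using S(2) fin by blast
    have "tropically_orthogonal (\<chi> i. ereal (v $ i)) (\<chi> i. circuit_vector p S $ i + ereal c) \<longleftrightarrow>
        (\<exists>i j. i \<noteq> j \<and> f j = f i \<and> (\<forall>k. f i \<le> f k))"
      unfolding tropically_orthogonal_def min_attained_twice_iff[OF finite]
      by (simp add: val[OF S(1)] f_def[symmetric]) (use ex in blast)
    also have "\<dots> \<longleftrightarrow> ?twice S"
    proof
      assume "\<exists>i j. i \<noteq> j \<and> f j = f i \<and> (\<forall>k. f i \<le> f k)"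
      then obtain i j where ij: "i \<noteq> j" "f j = f i" "\<And>k. f i \<le> f k" by blast
      obtain l where "f l \<noteq> \<infinity>" using ex by blast
      then have "f i \<noteq> \<infinity>" using ij(3)[of l] by auto
      then have i: "i \<in> S" "S - {i} \<in> ?\<M>" and j: "j \<in> S" "S - {j} \<in> ?\<M>"
        using fin[of i] fin[of j] ij(2) by auto
      have "basis_weight p v (S - {k}) \<le> basis_weight p v (S - {i})"
        if "k \<in> S" "S - {k} \<in> ?\<M>" for k
        using ij(3)[of k] fval[OF i] fval[OF that] by simp
      moreover have "basis_weight p v (S - {j}) = basis_weight p v (S - {i})"
        using ij(2) fval[OF i] fval[OF j] by simp
      ultimately show "?twice S" using i j ij(1) by (intro bexI[of _ i] bexI[of _ j]) auto
    next
      assume "?twice S"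
      then obtain i j where i: "i \<in> S" "S - {i} \<in> ?\<M>" and j: "j \<in> S" "S - {j} \<in> ?\<M>" and
        ij: "i \<noteq> j" "basis_weight p v (S - {j}) = basis_weight p v (S - {i})"
        "\<And>k. k \<in> S \<Longrightarrow> S - {k} \<in> ?\<M> \<Longrightarrow> basis_weight p v (S - {k}) \<le> basis_weight p v (S - {i})" by blast
      have "f j = f i" using fval[OF i] fval[OF j] ij(2) by simp
      moreover have "f i \<le> f k" for k
        using fval[OF i] ij(3)[of k] by (cases "k \<in> S \<and> S - {k} \<in> ?\<M>") (auto simp: f_def)
      ultimately show "\<exists>i j. i \<noteq> j \<and> f j = f i \<and> (\<forall>k. f i \<le> f k)" using ij(1) by blast
    qed
    finally show ?thesis .
  qed
  have "v \<in> real_part m p \<longleftrightarrow> (\<forall>S c. card S = m + 1 \<longrightarrow> circuit_vector p S \<noteq> (\<chi> i. \<infinity>) \<longrightarrow>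
      tropically_orthogonal (\<chi> i. ereal (v $ i)) (\<chi> i. circuit_vector p S $ i + ereal c))"
    unfolding real_part_def tropical_linear_space_def circuits_def by auto
  then show ?thesis using ne orth by auto
qed

text \<open>
  In the Pluecker relation for \<open>A - i\<close> and \<open>T\<close> the term of \<open>i\<close> is \<open>p A + p (T - i)\<close>.  As it is not the
  unique minimum, some other term is at most as large; adding the coordinates of \<open>v\<close>, which have the
  same total in all terms, turns this into the inequality between weights.
\<close>

lemma pluecker_exchange:
  fixes p :: "'n::finite set \<Rightarrow> ereal"
  assumes p: "tropical_pluecker m p" and A: "A \<in> matroid_bases m p"
    and T: "card T = m + 1" "T - {i} \<in> matroid_bases m p" and i: "i \<in> A" "i \<in> T"
  obtains j where "j \<in> T" "j \<noteq> i" "insert j (A - {i}) \<in> matroid_bases m p" "T - {j} \<in> matroid_bases m p"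
    "basis_weight p v A + basis_weight p v (T - {i}) \<le>
     basis_weight p v (insert j (A - {i})) + basis_weight p v (T - {j})"
proof -
  let ?\<M> = "matroid_bases m p"
  let ?S = "A - {i}"
  define f where "f j = p (insert j ?S) + p (T - {j})" for j
  have cA: "card A = m" using A by (simp add: matroid_bases_def)
  have cS: "card ?S + 1 = m" using card.remove[OF finite i(1)] cA by simp
  have pm: "p X \<noteq> -\<infinity>" if "card X = m" for X using p that by (simp add: tropical_pluecker_def)
  obtain x y where xy: "p A = ereal x" "p (T - {i}) = ereal y"
    using finite_on_bases[OF p] A T(2) by metis
  have fi: "f i = ereal (x + y)" using xy insert_Diff[OF i(1)] by (simp add: f_def)
  have "min_attained_twice (T - ?S) f"
    using p T(1) cS unfolding tropical_pluecker_def f_def[abs_def] by blast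
  moreover have iT: "i \<in> T - ?S" using i by auto
  moreover have "\<not> (\<forall>j\<in>T - ?S. f j = \<infinity>)"
  proof
    assume "\<forall>j\<in>T - ?S. f j = \<infinity>"
    then have "f i = \<infinity>" using iT by (rule bspec)
    then show False using fi by simp
  qed
  ultimately obtain k l where kl: "k \<in> T - ?S" "l \<in> T - ?S" "k \<noteq> l" "f l = f k" "\<forall>j\<in>T - ?S. f k \<le> f j"
    unfolding min_attained_twice_iff[OF finite] by blast
  obtain j where j: "j \<in> T - ?S" "j \<noteq> i" "f j \<le> f i"
  proof (cases "k = i")
    case True
    then show ?thesis using that[of l] kl(2-4) by simp
  next
    case False
    then show ?thesis using that[OF kl(1)] kl(5) iT by blast
  qed
  then have fj: "f j \<le> ereal (x + y)" using fi by simp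
  have cj: "card (insert j ?S) = m" using j cS by simp
  have cT: "card (T - {j}) = m" using j T(1) by simp
  have "f j \<noteq> \<infinity>" using fj by auto
  then have "p (insert j ?S) \<noteq> \<infinity>" "p (T - {j}) \<noteq> \<infinity>" using pm[OF cj] pm[OF cT] by (auto simp: f_def)
  then have jM: "insert j ?S \<in> ?\<M>" "T - {j} \<in> ?\<M>" using cj cT by (auto simp: matroid_bases_def)
  obtain x' y' where xy': "p (insert j ?S) = ereal x'" "p (T - {j}) = ereal y'"
    using finite_on_bases[OF p] jM by metis
  have le: "real_of_ereal (p (insert j ?S)) + real_of_ereal (p (T - {j})) \<le>
      real_of_ereal (p A) + real_of_ereal (p (T - {i}))"
    using fj xy xy' by (simp add: f_def)
  have "(\<Sum>k\<in>A. v $ k) = v $ i + (\<Sum>k\<in>?S. v $ k)" using i by (simp add: sum.remove)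
  moreover have "(\<Sum>k\<in>insert j ?S. v $ k) = v $ j + (\<Sum>k\<in>?S. v $ k)" using j by simp
  moreover have "(\<Sum>k\<in>T. v $ k) = v $ i + (\<Sum>k\<in>T - {i}. v $ k)" using i by (simp add: sum.remove)
  moreover have "(\<Sum>k\<in>T. v $ k) = v $ j + (\<Sum>k\<in>T - {j}. v $ k)" using j by (simp add: sum.remove)
  ultimately have "basis_weight p v A + basis_weight p v (T - {i}) \<le>
     basis_weight p v (insert j ?S) + basis_weight p v (T - {j})"
    using le unfolding basis_weight_def by linarith
  then show ?thesis using that j jM by blast
qed

lemma initial_bases_nonempty:
  fixes p :: "'n::finite set \<Rightarrow> ereal"
  assumes "tropical_pluecker m p"
  shows "initial_bases m p v \<noteq> {}"
proof -
  let ?\<M> = "matroid_bases m p"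
  have "?\<M> \<noteq> {}" using assms by (auto simp: tropical_pluecker_def matroid_bases_def)
  then have "Max (basis_weight p v ` ?\<M>) \<in> basis_weight p v ` ?\<M>" by (intro Max_in) auto
  then obtain A where A: "A \<in> ?\<M>" "basis_weight p v A = Max (basis_weight p v ` ?\<M>)" by auto
  have "basis_weight p v A' \<le> basis_weight p v A" if "A' \<in> ?\<M>" for A'
    unfolding A(2) using that by (intro Max_ge) auto
  then have "A \<in> initial_bases m p v" using A(1) by (simp add: initial_bases_def)
  then show ?thesis by blast
qed

text \<open>
  If \<open>v \<in> L(p)\<close> and an optimal basis \<open>A\<close> misses \<open>k\<close>, the circuit condition on \<open>A \<union> k\<close> yields two
  optimal bases inside \<open>A \<union> k\<close>, and one of them contains \<open>k\<close>.  Conversely let \<open>S - i\<close> be a basis of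
  maximal weight among those inside \<open>S\<close>, and exchange with an optimal basis containing \<open>i\<close>: the new
  basis cannot beat the optimal one, so \<open>S - j\<close> is as good as \<open>S - i\<close>.
\<close>

lemma real_part_iff_loopless:
  fixes p :: "'n::finite set \<Rightarrow> ereal"
  assumes p: "tropical_pluecker m p"
  shows "v \<in> real_part m p \<longleftrightarrow> \<Union> (initial_bases m p v) = UNIV"
proof
  let ?\<M> = "matroid_bases m p" and ?\<omega> = "basis_weight p v"
  assume v: "v \<in> real_part m p"
  obtain A where A: "A \<in> initial_bases m p v" using initial_bases_nonempty[OF p] by blast
  then have AM: "A \<in> ?\<M>" and max: "\<And>A'. A' \<in> ?\<M> \<Longrightarrow> ?\<omega> A' \<le> ?\<omega> A"
    by (auto simp: initial_bases_def)
  have "\<exists>A\<in>initial_bases m p v. k \<in> A" for k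
  proof (cases "k \<in> A")
    case False
    let ?S = "insert k A"
    have Sk: "?S - {k} = A" using False by auto
    have cS: "card ?S = m + 1" using AM False by (simp add: matroid_bases_def)
    have base: "\<exists>i\<in>?S. ?S - {i} \<in> ?\<M>" using AM Sk by (intro bexI[of _ k]) simp_all
    obtain i j where ij: "i \<noteq> j" "?S - {i} \<in> ?\<M>" "?S - {j} \<in> ?\<M>" "?\<omega> (?S - {j}) = ?\<omega> (?S - {i})"
      "\<forall>l\<in>?S. ?S - {l} \<in> ?\<M> \<longrightarrow> ?\<omega> (?S - {l}) \<le> ?\<omega> (?S - {i})"
      using v[unfolded real_part_iff_weights[OF p], rule_format, OF cS base] by blast
    have "?\<omega> A \<le> ?\<omega> (?S - {i})" using ij(5)[rule_format, of k] AM unfolding Sk by simp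
    then have opt: "?S - {i} \<in> initial_bases m p v" "?S - {j} \<in> initial_bases m p v"
      using ij(2-4) max unfolding initial_bases_def by (auto intro: order_trans)
    show ?thesis
    proof (cases "i = k")
      case True
      then show ?thesis using opt(2) ij(1) by (intro bexI[OF _ opt(2)]) auto
    next
      case False
      then show ?thesis by (intro bexI[OF _ opt(1)]) auto
    qed
  qed (use A in blast)
  then show "\<Union> (initial_bases m p v) = UNIV" by blast
next
  let ?\<M> = "matroid_bases m p" and ?\<omega> = "basis_weight p v"
  assume loopless: "\<Union> (initial_bases m p v) = UNIV"
  show "v \<in> real_part m p" unfolding real_part_iff_weights[OF p]
  proof (intro allI impI)
    fix S assume S: "card S = m + 1" "\<exists>i\<in>S. S - {i} \<in> ?\<M>"
    let ?I = "{i \<in> S. S - {i} \<in> ?\<M>}"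
    let ?g = "\<lambda>i. ?\<omega> (S - {i})"
    have "Max (?g ` ?I) \<in> ?g ` ?I" using S(2) by (intro Max_in) auto
    then obtain i where i: "i \<in> S" "S - {i} \<in> ?\<M>" "?g i = Max (?g ` ?I)" by auto
    have max: "?g k \<le> ?g i" if "k \<in> S" "S - {k} \<in> ?\<M>" for k
      unfolding i(3) using that by (intro Max_ge) auto
    have "i \<in> \<Union> (initial_bases m p v)" using loopless by simp
    then obtain A where A: "A \<in> initial_bases m p v" "i \<in> A" by blast
    then have AM: "A \<in> ?\<M>" and Amax: "\<And>A'. A' \<in> ?\<M> \<Longrightarrow> ?\<omega> A' \<le> ?\<omega> A"
      by (auto simp: initial_bases_def)
    obtain j where j: "j \<in> S" "j \<noteq> i" "insert j (A - {i}) \<in> ?\<M>" "S - {j} \<in> ?\<M>"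
      "?\<omega> A + ?\<omega> (S - {i}) \<le> ?\<omega> (insert j (A - {i})) + ?\<omega> (S - {j})"
      by (rule pluecker_exchange[OF p AM S(1) i(2) A(2) i(1)])
    have "?\<omega> (S - {j}) = ?\<omega> (S - {i})"
      using j(5) Amax[OF j(3)] max[OF j(1,4)] by linarith
    then show "\<exists>i\<in>S. \<exists>j\<in>S. i \<noteq> j \<and> S - {i} \<in> ?\<M> \<and> S - {j} \<in> ?\<M> \<and>
        ?\<omega> (S - {j}) = ?\<omega> (S - {i}) \<and> (\<forall>k\<in>S. S - {k} \<in> ?\<M> \<longrightarrow> ?\<omega> (S - {k}) \<le> ?\<omega> (S - {i}))"
      using i(1,2) j(1,2,4) max by (intro bexI[of _ i] bexI[of _ j]) auto
  qed
qed

definition open_cell :: "nat \<Rightarrow> ('n::finite set \<Rightarrow> ereal) \<Rightarrow> 'n set set \<Rightarrow> (real ^ 'n) set" where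
  "open_cell m p \<N> = {v \<in> real_part m p. initial_bases m p v = \<N>}"

lemma open_cell_eq:
  assumes "tropical_pluecker m p" "v \<in> open_cell m p \<N>"
  shows "open_cell m p \<N> = {v. initial_bases m p v = \<N>}"
  using assms by (auto simp: open_cell_def real_part_iff_loopless)

lemma basis_weight_add:
  "basis_weight p (v + t *\<^sub>R u) A = basis_weight p v A + t * (\<Sum>k\<in>A. u $ k)"
  by (simp add: basis_weight_def sum.distrib sum_distrib_left)

lemma initial_bases_eqI:
  assumes "\<N> \<subseteq> matroid_bases m p" "\<N> \<noteq> {}"
    and "\<And>A A'. A \<in> \<N> \<Longrightarrow> A' \<in> \<N> \<Longrightarrow> basis_weight p v A = basis_weight p v A'"
    and "\<And>A A'. A \<in> \<N> \<Longrightarrow> A' \<in> matroid_bases m p - \<N> \<Longrightarrow> basis_weight p v A' < basis_weight p v A"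
  shows "initial_bases m p v = \<N>"
proof (intro equalityI subsetI)
  fix A assume A: "A \<in> initial_bases m p v"
  obtain A0 where "A0 \<in> \<N>" using assms(2) by blast
  then have "basis_weight p v A0 \<le> basis_weight p v A"
    using A assms(1) by (auto simp: initial_bases_def)
  moreover have "A \<in> matroid_bases m p" using A by (simp add: initial_bases_def)
  ultimately show "A \<in> \<N>" using assms(4)[OF \<open>A0 \<in> \<N>\<close>, of A] by fastforce
next
  fix A assume A: "A \<in> \<N>"
  have "basis_weight p v A' \<le> basis_weight p v A" if "A' \<in> matroid_bases m p" for A'
    using assms(3)[OF A, of A'] assms(4)[OF A, of A'] that by (cases "A' \<in> \<N>") auto
  then show "A \<in> initial_bases m p v" using A assms(1) by (auto simp: initial_bases_def)
qed

lemma initial_bases_weight: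
  assumes "A \<in> initial_bases m p v"
  shows "A' \<in> initial_bases m p v \<Longrightarrow> basis_weight p v A = basis_weight p v A'"
    and "A' \<in> matroid_bases m p - initial_bases m p v \<Longrightarrow> basis_weight p v A' < basis_weight p v A"
proof -
  assume "A' \<in> initial_bases m p v"
  then show "basis_weight p v A = basis_weight p v A'"
    using assms unfolding initial_bases_def by (auto intro: order.antisym)
next
  assume A': "A' \<in> matroid_bases m p - initial_bases m p v"
  show "basis_weight p v A' < basis_weight p v A"
  proof (rule ccontr)
    assume "\<not> ?thesis"
    then have "A' \<in> initial_bases m p v"
      using A' assms by (auto simp: initial_bases_def not_less intro: order_trans)
    then show False using A' by blast
  qed
qed

text \<open>
  Two points of the cell give equal weights to all bases in \<open>\<N>\<close>, so their difference has equal sums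
  over these bases.  Conversely a small step in such a direction keeps the finitely many strict
  inequalities between bases inside and outside \<open>\<N>\<close>.
\<close>

lemma aff_dim_open_cell:
  fixes p :: "'n::finite set \<Rightarrow> ereal"
  assumes p: "tropical_pluecker m p" and v: "v \<in> open_cell m p \<N>"
  shows "aff_dim (open_cell m p \<N>) = int (dim (sum_constant_space \<N>))"
proof -
  have cell: "open_cell m p \<N> = {v. initial_bases m p v = \<N>}" by (rule open_cell_eq[OF p v])
  have N: "initial_bases m p v = \<N>" using v by (simp add: open_cell_def)
  have Nne: "\<N> \<noteq> {}" using initial_bases_nonempty[OF p, of v] N by simp
  have NM: "\<N> \<subseteq> matroid_bases m p" using N by (auto simp: initial_bases_def)
  let ?X = "(\<lambda>x. x - v) ` open_cell m p \<N>"
  have "?X \<subseteq> sum_constant_space \<N>"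
  proof
    fix u assume "u \<in> ?X"
    then obtain x where x: "initial_bases m p x = \<N>" "u = x - v" unfolding cell by auto
    show "u \<in> sum_constant_space \<N>" unfolding sum_constant_space_def
    proof (intro CollectI ballI)
      fix A A' assume A: "A \<in> \<N>" "A' \<in> \<N>"
      have "basis_weight p x A = basis_weight p v A + (\<Sum>k\<in>A. u $ k)" for A
        using basis_weight_add[of p v 1 u A] x(2) by simp
      moreover have "basis_weight p x A = basis_weight p x A'"
        using A x(1) initial_bases_weight(1) by metis
      moreover have "basis_weight p v A = basis_weight p v A'"
        using A N initial_bases_weight(1) by metis
      ultimately show "(\<Sum>k\<in>A. u $ k) = (\<Sum>k\<in>A'. u $ k)" by simp
    qed
  qed
  moreover have "sum_constant_space \<N> \<subseteq> span ?X"
  proof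
    fix u assume u: "u \<in> sum_constant_space \<N>"
    have "\<forall>\<^sub>F t in at_right 0. \<forall>x\<in>\<N> \<times> (matroid_bases m p - \<N>).
        basis_weight p v (snd x) + t * (\<Sum>k\<in>snd x. u $ k) < basis_weight p v (fst x) + t * (\<Sum>k\<in>fst x. u $ k)"
    proof (rule eventually_ball_finite)
      show "\<forall>x\<in>\<N> \<times> (matroid_bases m p - \<N>). \<forall>\<^sub>F t in at_right 0.
        basis_weight p v (snd x) + t * (\<Sum>k\<in>snd x. u $ k) < basis_weight p v (fst x) + t * (\<Sum>k\<in>fst x. u $ k)"
      proof
        fix x assume x: "x \<in> \<N> \<times> (matroid_bases m p - \<N>)"
        let ?g = "\<lambda>A t. basis_weight p v A + t * (\<Sum>k\<in>A. u $ k)"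
        have "((\<lambda>t. ?g (fst x) t - ?g (snd x) t) \<longlongrightarrow> ?g (fst x) 0 - ?g (snd x) 0) (at_right 0)"
          by (intro tendsto_intros)
        moreover have "0 < ?g (fst x) 0 - ?g (snd x) 0"
          using initial_bases_weight(2)[of "fst x" m p v "snd x"] x unfolding N by auto
        ultimately have "\<forall>\<^sub>F t in at_right 0. 0 < ?g (fst x) t - ?g (snd x) t"
          by (rule order_tendstoD(1))
        then show "\<forall>\<^sub>F t in at_right 0. ?g (snd x) t < ?g (fst x) t" by (rule eventually_mono) simp
      qed
    qed simp
    then have "\<forall>\<^sub>F t in at_right 0. 0 < t \<and> (\<forall>x\<in>\<N> \<times> (matroid_bases m p - \<N>).
        basis_weight p v (snd x) + t * (\<Sum>k\<in>snd x. u $ k) < basis_weight p v (fst x) + t * (\<Sum>k\<in>fst x. u $ k))"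
      using eventually_at_right_less[of "0::real"] by (intro eventually_conj)
    from eventually_happens'[OF trivial_limit_at_right_real this] obtain t where t: "0 < t"
      "\<And>A A'. A \<in> \<N> \<Longrightarrow> A' \<in> matroid_bases m p - \<N> \<Longrightarrow>
        basis_weight p v A' + t * (\<Sum>k\<in>A'. u $ k) < basis_weight p v A + t * (\<Sum>k\<in>A. u $ k)"
      by auto
    have "initial_bases m p (v + t *\<^sub>R u) = \<N>"
    proof (rule initial_bases_eqI[OF NM Nne])
      fix A A' assume A: "A \<in> \<N>" "A' \<in> \<N>"
      have "basis_weight p v A = basis_weight p v A'"
        using A N initial_bases_weight(1) by metis
      moreover have "(\<Sum>k\<in>A. u $ k) = (\<Sum>k\<in>A'. u $ k)"
        using u A unfolding sum_constant_space_def by blast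
      ultimately show "basis_weight p (v + t *\<^sub>R u) A = basis_weight p (v + t *\<^sub>R u) A'"
        by (simp add: basis_weight_add)
    qed (use t(2) in \<open>simp add: basis_weight_add\<close>)
    then have "t *\<^sub>R u \<in> ?X" unfolding cell by (intro image_eqI[of _ _ "v + t *\<^sub>R u"]) auto
    then have "(1 / t) *\<^sub>R (t *\<^sub>R u) \<in> span ?X" by (intro span_scale span_base)
    then show "u \<in> span ?X" using t(1) by simp
  qed
  ultimately have "dim ?X = dim (sum_constant_space \<N>)"
    by (intro order.antisym dim_subset dim_mono)
  moreover have "aff_dim (open_cell m p \<N>) = int (dim ?X)"
    using v by (intro aff_dim_eq_dim_subtract hull_inc)
  ultimately show ?thesis by simp
qed

text \<open>
  Differences of coordinates do not change along the lineality space, so they bound the quotient norm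
  from below.
\<close>

lemma infdist_lineality_ge:
  fixes x :: "real ^ 'n::finite"
  shows "\<bar>x $ k - x $ l\<bar> / 2 \<le> infdist x (span {1})"
proof -
  have le: "\<bar>x $ k - x $ l\<bar> / 2 \<le> dist x y" if y: "y \<in> span {1}" for y
  proof -
    obtain c where "y = c *\<^sub>R 1" using y by (auto simp: span_singleton)
    then have "y $ k = y $ l" by simp
    then have "\<bar>x $ k - x $ l\<bar> \<le> \<bar>(x - y) $ k\<bar> + \<bar>(x - y) $ l\<bar>" by simp
    also have "\<dots> \<le> 2 * norm (x - y)"
      using component_le_norm_cart[of "x - y" k] component_le_norm_cart[of "x - y" l] by simp
    finally show ?thesis by (simp add: dist_norm)
  qed
  have ne: "span {1 :: real ^ 'n} \<noteq> {}" using span_zero by blast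
  show ?thesis unfolding infdist_notempty[OF ne] using ne le by (rule cINF_greatest)
qed

text \<open>
  If \<open>k\<close> lies in all bases in \<open>\<N>\<close>, raising the coordinate \<open>k\<close> raises their weights at least as much as
  that of any other basis.  The cell then contains a ray in direction \<open>e\<^sub>k\<close>, along which the difference
  to another coordinate \<open>l\<close> grows without bound.
\<close>

lemma bounded_cell_coloopless:
  fixes p :: "'n::finite set \<Rightarrow> ereal"
  assumes p: "tropical_pluecker m p" and n: "1 < CARD('n)" and v: "v \<in> open_cell m p \<N>"
    and bounded: "bounded_mod_lineality (closure (open_cell m p \<N>))"
  shows "\<Inter> \<N> = {}"
proof (rule ccontr)
  assume "\<Inter> \<N> \<noteq> {}"
  then obtain k where k: "\<And>A. A \<in> \<N> \<Longrightarrow> k \<in> A" by blast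
  have cell: "open_cell m p \<N> = {v. initial_bases m p v = \<N>}" by (rule open_cell_eq[OF p v])
  have N: "initial_bases m p v = \<N>" using v by (simp add: open_cell_def)
  have Nne: "\<N> \<noteq> {}" using initial_bases_nonempty[OF p, of v] N by simp
  have NM: "\<N> \<subseteq> matroid_bases m p" using N by (auto simp: initial_bases_def)
  have "card (UNIV - {k}) \<noteq> 0" using n by simp
  then obtain l where l: "l \<noteq> k" by (metis DiffE card_gt_0_iff ex_in_conv not_gr_zero singletonI)
  have ray: "v + t *\<^sub>R axis k 1 \<in> open_cell m p \<N>" if t: "0 \<le> t" for t
  proof -
    have s: "(\<Sum>i\<in>A. axis k (1::real) $ i) = (if k \<in> A then 1 else 0)" for A
      by (simp add: axis_def)
    have "initial_bases m p (v + t *\<^sub>R axis k 1) = \<N>"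
    proof (rule initial_bases_eqI[OF NM Nne])
      fix A A' assume A: "A \<in> \<N>" "A' \<in> \<N>"
      have "basis_weight p v A = basis_weight p v A'"
        using A N initial_bases_weight(1) by metis
      then show "basis_weight p (v + t *\<^sub>R axis k 1) A = basis_weight p (v + t *\<^sub>R axis k 1) A'"
        unfolding basis_weight_add s using k A by simp
    next
      fix A A' assume A: "A \<in> \<N>" "A' \<in> matroid_bases m p - \<N>"
      have "basis_weight p v A' < basis_weight p v A"
        using A N initial_bases_weight(2) by metis
      then show "basis_weight p (v + t *\<^sub>R axis k 1) A' < basis_weight p (v + t *\<^sub>R axis k 1) A"
        unfolding basis_weight_add s using k[OF A(1)] t by simp
    qed
    then show ?thesis unfolding cell by simp
  qed
  obtain C where C: "\<And>x. x \<in> closure (open_cell m p \<N>) \<Longrightarrow> \<bar>infdist x (span {1})\<bar> \<le> C"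
    using bounded unfolding bounded_mod_lineality_def bounded_iff by auto
  \<comment> \<open>Large enough that the quotient norm, at least half the difference of the two coordinates, exceeds \<open>C\<close>.\<close>
  define t where "t = 2 * \<bar>C\<bar> + 1 + \<bar>v $ k - v $ l\<bar>"
  let ?x = "v + t *\<^sub>R axis k 1"
  have "?x \<in> closure (open_cell m p \<N>)"
    using ray[of t] closure_subset[of "open_cell m p \<N>"] by (auto simp: t_def)
  then have "infdist ?x (span {1}) \<le> C" using C by force
  then have "\<bar>?x $ k - ?x $ l\<bar> / 2 \<le> C" using infdist_lineality_ge[of ?x k l] by linarith
  moreover have "?x $ k - ?x $ l = v $ k - v $ l + t" using l by (simp add: axis_def)
  ultimately have "\<bar>v $ k - v $ l + t\<bar> / 2 \<le> C" by (simp only:)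
  then have "v $ k - v $ l + t \<le> 2 * C" using abs_ge_self[of "v $ k - v $ l + t"] by simp
  then show False
    using abs_ge_self[of C] abs_ge_minus_self[of "v $ k - v $ l"] by (simp add: t_def)
qed

text \<open>
  The inner product with \<open>e\<^sub>A\<close> takes the value \<open>m\<close> at \<open>e\<^sub>A\<close> and at most \<open>m - 1\<close> at the indicator vector of
  any other \<open>m\<close>-element set.  So a matroid polytope determines its set of bases.
\<close>

lemma matroid_polytope_subset:
  fixes \<N> \<N>' :: "'n::finite set set"
  assumes card: "\<And>A. A \<in> \<N> \<Longrightarrow> card A = m" "\<And>A. A \<in> \<N>' \<Longrightarrow> card A = m"
    and sub: "matroid_polytope \<N> \<subseteq> matroid_polytope \<N>'"
  shows "\<N> \<subseteq> \<N>'"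
proof
  fix A assume A: "A \<in> \<N>"
  define e where "e A = (\<Sum>i\<in>A. axis i 1 :: real ^ 'n)" for A
  have inner: "e A \<bullet> e A' = card (A \<inter> A')" for A A'
  proof -
    have "e A $ k = (if k \<in> A then 1 else 0)" for A k
      by (simp add: e_def axis_def)
    then have "e A \<bullet> e A' = (\<Sum>k\<in>UNIV. if k \<in> A \<inter> A' then 1 else 0)"
      unfolding inner_vec_def by (intro sum.cong) auto
    then show ?thesis by (simp add: sum.If_cases Int_def)
  qed
  have "e A \<in> convex hull (e ` \<N>')"
    using A sub unfolding matroid_polytope_def e_def by (blast intro: hull_inc)
  show "A \<in> \<N>'"
  proof (rule ccontr)
    assume nA: "A \<notin> \<N>'"
    have "e ` \<N>' \<subseteq> {x. e A \<bullet> x \<le> real m - 1}"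
    proof safe
      fix A' assume A': "A' \<in> \<N>'"
      have "A \<inter> A' \<noteq> A"
      proof
        assume "A \<inter> A' = A"
        then have "A = A'" using card(1)[OF A] card(2)[OF A'] by (intro card_subset_eq) auto
        then show False using nA A' by simp
      qed
      then have "card (A \<inter> A') < card A" by (intro psubset_card_mono) auto
      then show "e A \<bullet> e A' \<le> real m - 1" using card(1)[OF A] by (simp add: inner)
    qed
    then have "convex hull (e ` \<N>') \<subseteq> {x. e A \<bullet> x \<le> real m - 1}"
      by (intro hull_minimal convex_halfspace_le)
    then have "e A \<bullet> e A \<le> real m - 1" using \<open>e A \<in> convex hull (e ` \<N>')\<close> by blast
    then show False using card(1)[OF A] by (simp add: inner)
  qed
qed

section \<open>Incidence vectors of bipartite graphs\<close>

definition edge_vector :: "'n::finite \<times> 'n \<Rightarrow> real ^ 'n" where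
  "edge_vector e = axis (snd e) 1 - axis (fst e) 1"

text \<open>
  The functions that are constant on the connected components of the graph \<open>D\<close>; the dimension of this
  space serves as the number of components.
\<close>

definition level_space :: "('n::finite \<times> 'n) set \<Rightarrow> (real ^ 'n) set" where
  "level_space D = {u. \<forall>e\<in>D. u $ fst e = u $ snd e}"

text \<open>
  For a graph whose edges join \<open>B\<close> to its complement, distinct edges have distinct incidence vectors and
  linear independence of these vectors is acyclicity.  In this form the counting of edges
  becomes a dimension formula, and a dependency can be excluded by a generic choice of the matrix.
\<close>

definition forest :: "('n::finite \<times> 'n) set \<Rightarrow> bool" where
  "forest D \<longleftrightarrow> independent (edge_vector ` D)"

definition spanning_connected :: "('n::finite \<times> 'n) set \<Rightarrow> bool" where
  "spanning_connected D \<longleftrightarrow>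
     (\<forall>Y. Y \<noteq> {} \<longrightarrow> Y \<noteq> UNIV \<longrightarrow> (\<exists>e\<in>D. (fst e \<in> Y) \<noteq> (snd e \<in> Y)))"

lemma inner_edge_vector: "v \<bullet> edge_vector e = v $ snd e - v $ fst e"
  by (simp add: edge_vector_def inner_diff_right inner_axis)

lemma inj_on_edge_vector:
  assumes "D \<subseteq> B \<times> - B"
  shows "inj_on edge_vector D"
proof (rule inj_onI)
  fix d e assume de: "d \<in> D" "e \<in> D" "edge_vector d = edge_vector e"
  have dif: "fst d \<noteq> snd d" "fst e \<noteq> snd e" using de assms by auto
  have eq: "edge_vector d $ k = edge_vector e $ k" for k using de by simp
  have "snd d = snd e"
    using eq[of "snd d"] dif by (auto simp: edge_vector_def axis_def split: if_splits)
  moreover have "fst d = fst e"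
    using eq[of "fst d"] dif by (auto simp: edge_vector_def axis_def split: if_splits)
  ultimately show "d = e" by (simp add: prod_eq_iff)
qed

lemma card_Compl_add: "card (- X) + card X = CARD('n)" for X :: "'n::finite set"
  by (simp add: Compl_eq_Diff_UNIV card_Diff_subset card_mono)

lemma subspace_level_space: "subspace (level_space D)"
  by (auto simp: subspace_def level_space_def)

lemma level_space_mono: "D \<subseteq> D' \<Longrightarrow> level_space D' \<subseteq> level_space D"
  by (auto simp: level_space_def)

lemma level_space_orthogonal:
  "level_space D = {u \<in> UNIV. \<forall>x\<in>span (edge_vector ` D). orthogonal x u}"
proof -
  have "(\<forall>x\<in>span (edge_vector ` D). orthogonal x u) \<longleftrightarrow> (\<forall>e\<in>D. u $ fst e = u $ snd e)" for u
  proof -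
    have "(\<forall>x\<in>span (edge_vector ` D). orthogonal x u) \<longleftrightarrow> (\<forall>x\<in>edge_vector ` D. orthogonal u x)"
      by (meson orthogonal_commute orthogonal_to_span span_base)
    then show ?thesis by (auto simp: orthogonal_def inner_edge_vector)
  qed
  then show ?thesis by (auto simp: level_space_def)
qed

lemma dim_level_space:
  fixes D :: "('n::finite \<times> 'n) set"
  shows "dim (level_space D) + dim (edge_vector ` D) = CARD('n)"
  using dim_subspace_orthogonal_to_vectors[of "span (edge_vector ` D)" UNIV]
  by (simp add: level_space_orthogonal dim_span)

text \<open>
  The level space is the orthogonal complement of the incidence vectors, which gives the formula
  edges plus components equals vertices.
\<close>

lemma forest_card:
  fixes D :: "('n::finite \<times> 'n) set"
  assumes "D \<subseteq> B \<times> - B" "forest D"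
  shows "card D + dim (level_space D) = CARD('n)"
  using dim_level_space[of D] assms(2) card_image[OF inj_on_edge_vector[OF assms(1)]]
  by (simp add: forest_def dim_eq_card_independent)

lemma forest_subset: "forest D \<Longrightarrow> D' \<subseteq> D \<Longrightarrow> forest D'"
  unfolding forest_def by (meson image_mono independent_mono)

lemma spanning_connected_dim:
  fixes D :: "('n::finite \<times> 'n) set"
  assumes "spanning_connected D"
  shows "dim (level_space D) = 1"
proof -
  have "level_space D = span {1}"
  proof
    show "level_space D \<subseteq> span {1}"
    proof
      fix u assume u: "u \<in> level_space D"
      fix k0 :: 'n
      define Y where "Y = {k. u $ k = u $ k0}"
      have "\<forall>e\<in>D. (fst e \<in> Y) = (snd e \<in> Y)" using u by (auto simp: level_space_def Y_def)
      moreover have "Y \<noteq> {}" by (auto simp: Y_def)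
      ultimately have "Y = UNIV" using assms unfolding spanning_connected_def by metis
      then have "u = (u $ k0) *\<^sub>R 1" by (auto simp: Y_def vec_eq_iff)
      then show "u \<in> span {1}" by (metis span_base singletonI span_scale)
    qed
    have "1 \<in> level_space D" by (simp add: level_space_def)
    then show "span {1} \<subseteq> level_space D"
      by (simp add: span_minimal subspace_level_space)
  qed
  then show ?thesis by (simp add: dim_span dim_singleton)
qed

text \<open>
  The level space contains the indicator vector of \<open>X\<close> and the unit vectors outside \<open>X\<close>, so its
  dimension is at least \<open>card (- X) + 1\<close>.
\<close>

lemma forest_edges_within:
  fixes D :: "('n::finite \<times> 'n) set"
  assumes D: "D \<subseteq> B \<times> - B" "forest D" and X: "D \<subseteq> X \<times> X" "X \<noteq> {}"
  shows "card D + 1 \<le> card X"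
proof -
  let ?x = "(\<chi> k. if k \<in> X then 1 else 0) :: real ^ 'n"
  let ?S = "insert ?x ((\<lambda>k. axis k 1) ` (- X))"
  have notin: "?x \<notin> (\<lambda>k. axis k 1) ` (- X)"
  proof
    assume "?x \<in> (\<lambda>k. axis k 1) ` (- X)"
    then obtain k where k: "k \<notin> X" "?x = axis k 1" by auto
    have "?x $ k = 0" "axis k (1::real) $ k = 1" using k(1) by auto
    then show False using k(2) by simp
  qed
  have x0: "?x \<noteq> 0" using X(2) by (auto simp: vec_eq_iff)
  have "pairwise orthogonal ?S"
    by (auto simp: pairwise_insert pairwise_def orthogonal_def inner_axis inner_axis' axis_eq_axis)
       (auto simp: axis_def)
  moreover have "0 \<notin> ?S" using x0 by (auto simp: axis_eq_0_iff)
  ultimately have ind: "independent ?S" by (rule pairwise_orthogonal_independent)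
  have sub: "?S \<subseteq> level_space D"
    using X(1) by (auto simp: level_space_def axis_def)
  have "card ?S = card (- X) + 1"
    using notin by (simp add: card_image inj_on_def axis_eq_axis)
  moreover have "card ?S \<le> dim (level_space D)"
    using ind sub by (metis independent_card_le_dim)
  ultimately have "card (- X) + 1 \<le> dim (level_space D)" by simp
  moreover note card_Compl_add[of X]
  ultimately show ?thesis using forest_card[OF D] by linarith
qed

section \<open>Tight graphs of a generic matrix\<close>

definition feasible :: "'n::finite set \<Rightarrow> ('n \<Rightarrow> 'n \<Rightarrow> ereal) \<Rightarrow> real ^ 'n \<Rightarrow> bool" where
  "feasible B V v \<longleftrightarrow> (\<forall>b\<in>B. \<forall>a\<in>-B. ereal (v $ a - v $ b) \<le> V b a)"

definition tight_edges :: "'n::finite set \<Rightarrow> ('n \<Rightarrow> 'n \<Rightarrow> ereal) \<Rightarrow> real ^ 'n \<Rightarrow> ('n \<times> 'n) set" where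
  "tight_edges B V v = {e \<in> B \<times> - B. ereal (v $ snd e - v $ fst e) = V (fst e) (snd e)}"

text \<open>
  The equations of a tight graph are solved by the point that it belongs to, so for a generic matrix all tight
  graphs are forests.
\<close>

definition generic :: "'n::finite set \<Rightarrow> ('n \<Rightarrow> 'n \<Rightarrow> real) \<Rightarrow> bool" where
  "generic B V \<longleftrightarrow> (\<forall>D v. D \<subseteq> B \<times> - B \<longrightarrow> (\<forall>e\<in>D. v $ snd e - v $ fst e = V (fst e) (snd e)) \<longrightarrow>
     forest D)"

abbreviation real_tight :: "'n::finite set \<Rightarrow> ('n \<Rightarrow> 'n \<Rightarrow> real) \<Rightarrow> real ^ 'n \<Rightarrow> ('n \<times> 'n) set" where
  "real_tight B V \<equiv> tight_edges B (\<lambda>b a. ereal (V b a))"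

abbreviation real_feasible :: "'n::finite set \<Rightarrow> ('n \<Rightarrow> 'n \<Rightarrow> real) \<Rightarrow> real ^ 'n \<Rightarrow> bool" where
  "real_feasible B V \<equiv> feasible B (\<lambda>b a. ereal (V b a))"

definition no_isolated_vertex :: "('n \<times> 'n) set \<Rightarrow> bool" where
  "no_isolated_vertex D \<longleftrightarrow> fst ` D \<union> snd ` D = UNIV"

definition right_degree :: "('n \<times> 'n) set \<Rightarrow> 'n \<Rightarrow> nat" where
  "right_degree D a = card {e \<in> D. snd e = a}"

lemma tight_edges_subset: "tight_edges B V v \<subseteq> B \<times> - B"
  by (auto simp: tight_edges_def)

lemma tight_iff: "e \<in> real_tight B V v \<longleftrightarrow> e \<in> B \<times> - B \<and> v $ snd e - v $ fst e = V (fst e) (snd e)"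
  by (auto simp: tight_edges_def)

lemma forest_tight: "generic B V \<Longrightarrow> forest (real_tight B V v)"
  unfolding generic_def using tight_edges_subset[of B _ v] tight_iff[of _ B V v] by blast

lemma sum_right_degree:
  fixes D :: "('n::finite \<times> 'n) set"
  shows "(\<Sum>a\<in>X. right_degree D a) = card {e \<in> D. snd e \<in> X}"
proof -
  have "{e \<in> D. snd e \<in> X} = (\<Union>a\<in>X. {e \<in> D. snd e = a})" by auto
  then have "card {e \<in> D. snd e \<in> X} = card (\<Union>a\<in>X. {e \<in> D. snd e = a})" by simp
  also have "\<dots> = (\<Sum>a\<in>X. right_degree D a)"
    unfolding right_degree_def by (subst card_UN_disjoint) auto
  finally show ?thesis by simp
qed

lemma spanning_tree_card:
  fixes D :: "('n::finite \<times> 'n) set"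
  assumes "D \<subseteq> B \<times> - B" "forest D" "spanning_connected D"
  shows "card D + 1 = CARD('n)"
  using forest_card[OF assms(1,2)] spanning_connected_dim[OF assms(3)] by simp

text \<open>
  Let \<open>d = v - v'\<close> and let \<open>X\<close> be the set where \<open>d\<close> is maximal.  From left to right, \<open>d\<close> does not
  decrease along the edges of the first tree, since these are tight at \<open>v\<close>, and does not
  increase along those of the second.  Hence edges of the first tree with right end outside \<open>X\<close> stay outside
  \<open>X\<close>, and edges of the second with right end in \<open>X\<close> stay inside.  If \<open>X\<close> were not everything, the
  equality of the right degrees would leave at most \<open>(card X - 1) + (card (- X) - 1)\<close> edges for the first
  tree, one less than a spanning tree has.  So \<open>d\<close> is constant.
\<close>

lemma tight_tree_unique:
  fixes v v' :: "real ^ 'n::finite"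
  assumes gen: "generic B V" and feas: "real_feasible B V v" "real_feasible B V v'"
    and con: "spanning_connected (real_tight B V v)" "spanning_connected (real_tight B V v')"
    and deg: "\<And>a. right_degree (real_tight B V v) a = right_degree (real_tight B V v') a"
  shows "real_tight B V v = real_tight B V v'"
proof -
  let ?T = "real_tight B V v" and ?T' = "real_tight B V v'"
  define d where "d k = v $ k - v' $ k" for k
  define X where "X = {k. d k = Max (range d)}"
  have le: "d k \<le> Max (range d)" for k by simp
  have T: "d (fst e) \<le> d (snd e)" if "e \<in> ?T" for e
  proof -
    have "v' $ snd e - v' $ fst e \<le> V (fst e) (snd e)"
      using that feas(2) by (cases e) (auto simp: feasible_def tight_iff)
    then show ?thesis using that by (auto simp: tight_iff d_def)
  qed
  have T': "d (snd e) \<le> d (fst e)" if "e \<in> ?T'" for e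
  proof -
    have "v $ snd e - v $ fst e \<le> V (fst e) (snd e)"
      using that feas(1) by (cases e) (auto simp: feasible_def tight_iff)
    then show ?thesis using that by (auto simp: tight_iff d_def)
  qed
  have "Max (range d) \<in> range d" by (rule Max_in) auto
  then have Xne: "X \<noteq> {}" unfolding X_def by (metis (mono_tags) empty_Collect_eq imageE)
  have "X = UNIV"
  proof (rule ccontr)
    assume "X \<noteq> UNIV"
    then have Xc: "- X \<noteq> {}" by auto
    have fT: "forest ?T" "forest ?T'" using gen by (rule forest_tight)+
    have sub: "?T \<subseteq> B \<times> - B" "?T' \<subseteq> B \<times> - B" by (rule tight_edges_subset)+
    let ?in = "{e \<in> ?T'. snd e \<in> X}" and ?out = "{e \<in> ?T. snd e \<notin> X}"
    have "?in \<subseteq> X \<times> X"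
    proof
      fix e assume e: "e \<in> ?in"
      then have "e \<in> ?T'" "d (snd e) = Max (range d)" by (auto simp: X_def)
      then have "d (fst e) = Max (range d)" using T'[of e] le[of "fst e"] by linarith
      then show "e \<in> X \<times> X" using e by (cases e) (auto simp: X_def)
    qed
    moreover have "?in \<subseteq> B \<times> - B" "forest ?in" using sub fT by (auto intro: forest_subset)
    ultimately have 1: "card ?in + 1 \<le> card X" using Xne by (intro forest_edges_within)
    have "?out \<subseteq> (- X) \<times> (- X)"
    proof
      fix e assume e: "e \<in> ?out"
      then have "e \<in> ?T" "d (snd e) \<noteq> Max (range d)" by (auto simp: X_def)
      then have "d (fst e) \<noteq> Max (range d)" using T[of e] le[of "snd e"] by linarith
      then show "e \<in> (- X) \<times> (- X)" using e by (cases e) (auto simp: X_def)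
    qed
    moreover have "?out \<subseteq> B \<times> - B" "forest ?out" using sub fT by (auto intro: forest_subset)
    ultimately have 2: "card ?out + 1 \<le> card (- X)" using Xc by (intro forest_edges_within)
    have "card ?in = card {e \<in> ?T. snd e \<in> X}"
      using deg by (simp add: sum_right_degree[symmetric])
    moreover have "card ?T = card {e \<in> ?T. snd e \<in> X} + card ?out"
      by (subst card_Un_disjoint[symmetric]) (auto intro: arg_cong[where f = card])
    moreover note card_Compl_add[of X]
    ultimately show False
      using 1 2 spanning_tree_card[OF sub(1) fT(1) con(1)] by linarith
  qed
  then have "d k = Max (range d)" for k by (auto simp: X_def)
  then have "v $ k - v $ l = v' $ k - v' $ l" for k l unfolding d_def
    by (smt (verit))
  then show ?thesis by (auto simp: tight_iff)
qed

text \<open>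
  The closed cell of \<open>v\<close>, cut down by fixing the coordinate \<open>a0\<close>, is compact because its graph has no
  isolated vertex.  At a point where the sum of the coordinates is maximal, the coordinates in \<open>Y\<close>
  cannot be raised together.  If no edge of the cell's graph crosses \<open>Y\<close>, the only obstacle is a tight
  edge that enters \<open>Y\<close> at its right end.
\<close>

lemma maximal_point_exists:
  fixes v :: "real ^ 'n::finite"
  assumes feas: "real_feasible B V v" and cov: "no_isolated_vertex (real_tight B V v)" and a0: "a0 \<notin> B"
  obtains v' where "real_feasible B V v'" "real_tight B V v \<subseteq> real_tight B V v'"
    "\<And>Y. Y \<noteq> {} \<Longrightarrow> a0 \<notin> Y \<Longrightarrow> (\<And>e. e \<in> real_tight B V v \<Longrightarrow> (fst e \<in> Y) = (snd e \<in> Y)) \<Longrightarrow>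
       \<exists>e\<in>real_tight B V v'. fst e \<notin> Y \<and> snd e \<in> Y"
proof -
  let ?F = "real_tight B V v"
  define P where "P = {x :: real ^ 'n. real_feasible B V x \<and> ?F \<subseteq> real_tight B V x \<and> x $ a0 = 0}"
  have ne: "(\<chi> k. v $ k - v $ a0) \<in> P"
    using feas by (auto simp: P_def feasible_def tight_iff)
  have P_eq: "P = (\<Inter>b\<in>B. \<Inter>a\<in>-B. {x. x $ a - x $ b \<le> V b a}) \<inter>
      (\<Inter>e\<in>?F. {x. x $ snd e - x $ fst e = V (fst e) (snd e)}) \<inter> {x. x $ a0 = 0}"
  proof -
    have "?F \<subseteq> real_tight B V x \<longleftrightarrow> (\<forall>e\<in>?F. x $ snd e - x $ fst e = V (fst e) (snd e))" for x
      unfolding subset_iff by (metis tight_iff)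
    then show ?thesis unfolding P_def feasible_def by auto
  qed
  have "closed P" unfolding P_eq
    by (intro closed_Int closed_INT ballI closed_Collect_le closed_Collect_eq continuous_intros)
  \<comment> \<open>Left coordinates are bounded below by the inequalities at \<open>a0\<close>, right coordinates above by those at
    a neighbour \<open>b0\<close> of \<open>a0\<close>; the tight edge at each vertex supplies the other bound.\<close>
  moreover have "bounded P"
  proof -
    have cov': "\<exists>e\<in>?F. k = fst e \<or> k = snd e" for k
      using cov unfolding no_isolated_vertex_def by (metis UNIV_I Un_iff imageE)
    obtain b0 where b0: "(b0, a0) \<in> ?F"
    proof -
      obtain e where e: "e \<in> ?F" "a0 = fst e \<or> a0 = snd e" using cov' by blast
      then have "e = (fst e, a0)" using a0 by (auto simp: tight_iff prod_eq_iff)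
      then show ?thesis using e(1) that by metis
    qed
    define M where "M = (\<Sum>b\<in>UNIV. \<Sum>a\<in>UNIV. \<bar>V b a\<bar>)"
    have VM: "\<bar>V b a\<bar> \<le> M" for b a
    proof -
      have "\<bar>V b a\<bar> \<le> (\<Sum>a\<in>UNIV. \<bar>V b a\<bar>)" by (rule member_le_sum) auto
      also have "\<dots> \<le> M" unfolding M_def
        by (rule member_le_sum[of b UNIV "\<lambda>b. \<Sum>a\<in>UNIV. \<bar>V b a\<bar>"]) (auto intro: sum_nonneg)
      finally show ?thesis .
    qed
    have "\<bar>x $ k\<bar> \<le> 3 * M" if x: "x \<in> P" for x k
    proof -
      have le: "x $ a - x $ b \<le> V b a" if "b \<in> B" "a \<notin> B" for a b
        using x that by (auto simp: P_def feasible_def)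
      have eq: "x $ snd e - x $ fst e = V (fst e) (snd e)" if "e \<in> ?F" for e
      proof -
        have "e \<in> real_tight B V x" using x that by (auto simp: P_def)
        then show ?thesis by (simp add: tight_iff)
      qed
      have x0: "x $ a0 = 0" using x by (simp add: P_def)
      have B0: "b0 \<in> B" using b0 by (auto simp: tight_iff)
      have xb0: "\<bar>x $ b0\<bar> \<le> M" using eq[OF b0] x0 VM[of b0 a0] by simp
      have lowB: "- M \<le> x $ b" if "b \<in> B" for b
        using le[OF that a0] x0 VM[of b a0] by simp
      have upA: "x $ a \<le> 2 * M" if "a \<notin> B" for a
        using le[OF B0 that] xb0 VM[of b0 a] by linarith
      obtain e where e: "e \<in> ?F" "k = fst e \<or> k = snd e" using cov' by blast
      have eB: "fst e \<in> B" "snd e \<notin> B" using e by (auto simp: tight_iff)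
      show ?thesis
        using eq[OF e(1)] lowB[OF eB(1)] upA[OF eB(2)] VM[of "fst e" "snd e"] e(2) by auto
    qed
    then have "norm x \<le> CARD('n) * (3 * M)" if "x \<in> P" for x
      using norm_le_l1_cart[of x] sum_bounded_above[of UNIV "\<lambda>k. \<bar>x $ k\<bar>" "3 * M"] that by force
    then show ?thesis by (rule boundedI)
  qed
  ultimately have "compact P" by (simp add: compact_eq_bounded_closed)
  moreover have "continuous_on P (\<lambda>x. \<Sum>k\<in>UNIV. x $ k)" by (intro continuous_intros)
  ultimately obtain v' where v': "v' \<in> P" and
    max: "\<And>x. x \<in> P \<Longrightarrow> (\<Sum>k\<in>UNIV. x $ k) \<le> (\<Sum>k\<in>UNIV. v' $ k)"
    using continuous_attains_sup[of P "\<lambda>x. \<Sum>k\<in>UNIV. x $ k"] ne by blast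
  have feas': "real_feasible B V v'" and sub: "?F \<subseteq> real_tight B V v'" and v0: "v' $ a0 = 0"
    using v' by (auto simp: P_def)
  show ?thesis
  proof (rule that[OF feas' sub])
    fix Y assume Y: "Y \<noteq> {}" "a0 \<notin> Y" "\<And>e. e \<in> ?F \<Longrightarrow> (fst e \<in> Y) = (snd e \<in> Y)"
    show "\<exists>e\<in>real_tight B V v'. fst e \<notin> Y \<and> snd e \<in> Y"
    proof (rule ccontr)
      assume no: "\<not> ?thesis"
      let ?E = "(B \<times> - B) \<inter> ((- Y) \<times> Y)"
      define s where "s e = V (fst e) (snd e) - (v' $ snd e - v' $ fst e)" for e
      have pos: "0 < s e" if "e \<in> ?E" for e
      proof -
        have "0 \<le> s e" using that feas' by (auto simp: s_def feasible_def)
        moreover have "e \<notin> real_tight B V v'" using that no by auto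
        then have "s e \<noteq> 0" using that by (auto simp: s_def tight_iff)
        ultimately show ?thesis by simp
      qed
      \<comment> \<open>The least slack of an edge entering \<open>Y\<close>; the entry 1 covers the case that there is none.\<close>
      define t where "t = Min (insert 1 (s ` ?E))"
      have t: "0 < t" unfolding t_def using pos by (subst Min_gr_iff) auto
      have ts: "t \<le> s e" if "e \<in> ?E" for e unfolding t_def by (rule Min_le) (use that in auto)
      define x :: "real ^ 'n" where "x = (\<chi> k. v' $ k + (if k \<in> Y then t else 0))"
      have "real_feasible B V x" unfolding feasible_def
      proof (intro ballI)
        fix b a assume ba: "b \<in> B" "a \<in> - B"
        have le: "v' $ a - v' $ b \<le> V b a" using feas' ba by (auto simp: feasible_def)
        have "t \<le> V b a - (v' $ a - v' $ b)" if "b \<notin> Y" "a \<in> Y"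
          using ts[of "(b, a)"] ba that by (simp add: s_def)
        then show "ereal (x $ a - x $ b) \<le> ereal (V b a)"
          using le t by (auto simp: x_def)
      qed
      moreover have "?F \<subseteq> real_tight B V x"
      proof
        fix e assume e: "e \<in> ?F"
        then have "e \<in> real_tight B V v'" using sub by blast
        then show "e \<in> real_tight B V x" using Y(3)[OF e] by (auto simp: tight_iff x_def)
      qed
      ultimately have "x \<in> P" using v0 Y(2) by (simp add: P_def x_def)
      then have "(\<Sum>k\<in>UNIV. x $ k) \<le> (\<Sum>k\<in>UNIV. v' $ k)" by (rule max)
      then have "(\<Sum>k\<in>UNIV. if k \<in> Y then t else 0) \<le> 0"
        by (simp add: x_def sum.distrib)
      moreover have "(\<Sum>k\<in>UNIV. if k \<in> Y then t else 0) = card Y * t"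
        by (simp add: sum.If_cases)
      ultimately show False using t Y(1) by (simp add: mult_le_0_iff)
    qed
  qed
qed

text \<open>
  For a spanning tree \<open>T\<close> with root \<open>a0\<close> these are the edges directed from their left end, as parent, to
  their right end, as child; \<open>Y\<close> is the part of the tree that is cut off from the root by removing \<open>e\<close>.
\<close>

definition entering :: "'n \<Rightarrow> ('n \<times> 'n) set \<Rightarrow> ('n \<times> 'n) \<Rightarrow> bool" where
  "entering a0 T e \<longleftrightarrow> e \<in> T \<and> (\<exists>Y. a0 \<notin> Y \<and> fst e \<notin> Y \<and> snd e \<in> Y \<and>
     (\<forall>e'\<in>T. e' \<noteq> e \<longrightarrow> (fst e' \<in> Y) = (snd e' \<in> Y)))"

text \<open>
  A vertex has only one parent: for two such edges, each left end would lie in the part cut off by the other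
  edge, and no edge of \<open>T\<close> would leave the union of the two parts.
\<close>

lemma entering_unique:
  assumes con: "spanning_connected T"
    and e: "entering a0 T e" "entering a0 T e'" and snd: "snd e = snd e'"
  shows "e = e'"
proof (rule ccontr)
  assume ne: "e \<noteq> e'"
  obtain Y where Y: "a0 \<notin> Y" "fst e \<notin> Y" "snd e \<in> Y"
    "\<And>d. d \<in> T \<Longrightarrow> d \<noteq> e \<Longrightarrow> (fst d \<in> Y) = (snd d \<in> Y)" and eT: "e \<in> T"
    using e(1) unfolding entering_def by blast
  obtain Y' where Y': "a0 \<notin> Y'" "fst e' \<notin> Y'" "snd e' \<in> Y'"
    "\<And>d. d \<in> T \<Longrightarrow> d \<noteq> e' \<Longrightarrow> (fst d \<in> Y') = (snd d \<in> Y')" and eT': "e' \<in> T"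
    using e(2) unfolding entering_def by blast
  have "fst e \<in> Y'" using Y'(4)[OF eT ne] Y'(3) snd by simp
  moreover have "fst e' \<in> Y" using Y(4)[OF eT' ne[symmetric]] Y(3) snd by simp
  ultimately have "\<forall>d\<in>T. (fst d \<in> Y \<union> Y') = (snd d \<in> Y \<union> Y')"
    using Y Y' snd by (metis UnCI UnE)
  moreover have "Y \<union> Y' \<noteq> {}" "Y \<union> Y' \<noteq> UNIV" using Y Y' by auto
  ultimately show False using con unfolding spanning_connected_def by metis
qed

text \<open>
  Without \<open>e\<close> the level space has dimension two, so it contains a nonconstant function; \<open>Y\<close> is the set
  where that function differs from its value at \<open>a0\<close>.
\<close>

lemma forest_cut:
  fixes T :: "('n::finite \<times> 'n) set"
  assumes T: "T \<subseteq> B \<times> - B" "forest T" "spanning_connected T" and e: "e \<in> T"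
  obtains Y where "a0 \<notin> Y" "Y \<noteq> {}" "\<And>d. d \<in> T \<Longrightarrow> d \<noteq> e \<Longrightarrow> (fst d \<in> Y) = (snd d \<in> Y)"
proof -
  have "Suc (card (T - {e})) = card T" using e by (intro card_Suc_Diff1) auto
  moreover have "card (T - {e}) + dim (level_space (T - {e})) = CARD('n)"
    using T(1) by (intro forest_card[of _ B] forest_subset[OF T(2)]) auto
  ultimately have dim2: "dim (level_space (T - {e})) = 2"
    using spanning_tree_card[OF T] by simp
  have "\<not> level_space (T - {e}) \<subseteq> span {1}"
  proof
    assume "level_space (T - {e}) \<subseteq> span {1}"
    then have "dim (level_space (T - {e})) \<le> card {1 :: real ^ 'n}" by (rule dim_le_card) simp
    then show False using dim2 by simp
  qed
  then obtain u where u: "u \<in> level_space (T - {e})" "u \<notin> span {1}" by blast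
  define Y where "Y = {k. u $ k \<noteq> u $ a0}"
  show ?thesis
  proof
    show "a0 \<notin> Y" by (simp add: Y_def)
    show "Y \<noteq> {}"
    proof
      assume "Y = {}"
      then have "u = (u $ a0) *\<^sub>R 1" by (auto simp: Y_def vec_eq_iff)
      then show False using u(2) by (metis span_base singletonI span_scale)
    qed
    show "(fst d \<in> Y) = (snd d \<in> Y)" if "d \<in> T" "d \<noteq> e" for d
      using u(1) that by (auto simp: level_space_def Y_def)
  qed
qed

text \<open>
  At the maximal point of the closed cell every nonempty set \<open>Y\<close> not containing \<open>a0\<close> and not crossed by the
  forest \<open>F\<close> of the cell is entered by a tight edge.  This shows that the tight graph is connected, and, for the
  part \<open>Y\<close> cut off by a tight edge \<open>e\<close> outside \<open>F\<close>, that \<open>e\<close> itself enters \<open>Y\<close>.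
\<close>

lemma maximal_point_tree:
  fixes v :: "real ^ 'n::finite"
  assumes gen: "generic B V" and feas: "real_feasible B V v" and cov: "no_isolated_vertex (real_tight B V v)"
    and a0: "a0 \<notin> B"
  obtains v' where "real_feasible B V v'" "real_tight B V v \<subseteq> real_tight B V v'" "spanning_connected (real_tight B V v')"
    "\<And>e. e \<in> real_tight B V v' - real_tight B V v \<Longrightarrow> entering a0 (real_tight B V v') e"
proof -
  let ?F = "real_tight B V v"
  obtain v' where v': "real_feasible B V v'" "?F \<subseteq> real_tight B V v'" and
    max: "\<And>Y. Y \<noteq> {} \<Longrightarrow> a0 \<notin> Y \<Longrightarrow> (\<And>e. e \<in> ?F \<Longrightarrow> (fst e \<in> Y) = (snd e \<in> Y)) \<Longrightarrow>
       \<exists>e\<in>real_tight B V v'. fst e \<notin> Y \<and> snd e \<in> Y"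
    using maximal_point_exists[OF feas cov a0] by blast
  let ?T = "real_tight B V v'"
  have con: "spanning_connected ?T" unfolding spanning_connected_def
  proof (intro allI impI)
    fix Y :: "'n set" assume Y: "Y \<noteq> {}" "Y \<noteq> UNIV"
    show "\<exists>e\<in>?T. (fst e \<in> Y) \<noteq> (snd e \<in> Y)"
    proof (rule ccontr)
      assume no: "\<not> ?thesis"
      define Z where "Z = (if a0 \<in> Y then - Y else Y)"
      have "Z \<noteq> {}" "a0 \<notin> Z" using Y by (auto simp: Z_def)
      moreover have cross: "(fst e \<in> Z) = (snd e \<in> Z)" if "e \<in> ?T" for e
        using no that by (auto simp: Z_def)
      ultimately show False using max[of Z] v'(2) by (metis subsetD)
    qed
  qed
  show ?thesis
  proof (rule that[OF v' con])
    fix e assume e: "e \<in> ?T - ?F"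
    obtain Y where Y: "a0 \<notin> Y" "Y \<noteq> {}"
      "\<And>d. d \<in> ?T \<Longrightarrow> d \<noteq> e \<Longrightarrow> (fst d \<in> Y) = (snd d \<in> Y)"
      using forest_cut[OF tight_edges_subset forest_tight[OF gen] con, of e a0] e by blast
    have "(fst d \<in> Y) = (snd d \<in> Y)" if "d \<in> ?F" for d
      using Y(3)[of d] that v'(2) e by blast
    then obtain d where d: "d \<in> ?T" "fst d \<notin> Y" "snd d \<in> Y" using max[OF Y(2,1)] by blast
    then have "d = e" using Y(3)[of d] by blast
    then show "entering a0 ?T e" using d Y unfolding entering_def by blast
  qed
qed

section \<open>Counting tight forests of a generic matrix\<close>

text \<open>
  Listing the values of \<open>f\<close> along an enumeration of \<open>A\<close> reduces this to lists with a given sum.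
\<close>

lemma card_weak_compositions:
  fixes A :: "'n set"
  assumes "finite A" "A \<noteq> {}"
  shows "finite {f. (\<forall>a. a \<notin> A \<longrightarrow> f a = (0::nat)) \<and> sum f A = N}"
    and "card {f. (\<forall>a. a \<notin> A \<longrightarrow> f a = (0::nat)) \<and> sum f A = N} = (N + card A - 1) choose N"
proof -
  let ?S = "{f. (\<forall>a. a \<notin> A \<longrightarrow> f a = (0::nat)) \<and> sum f A = N}"
  let ?L = "{l :: nat list. length l = card A \<and> sum_list l = N}"
  obtain xs where xs: "set xs = A" "distinct xs" using finite_distinct_list[OF assms(1)] by blast
  have len: "length xs = card A" using distinct_card[OF xs(2)] xs(1) by simp
  have bij: "bij_betw (\<lambda>f. map f xs) ?S ?L"
  proof (rule bij_betw_imageI)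
    show "inj_on (\<lambda>f. map f xs) ?S"
    proof (rule inj_onI)
      fix f g assume f: "f \<in> ?S" and g: "g \<in> ?S" and eq: "map f xs = map g xs"
      have "f a = g a" for a
      proof (cases "a \<in> A")
        case True
        then show ?thesis using eq xs(1) by (simp add: map_eq_conv)
      next
        case False
        then show ?thesis using f g by simp
      qed
      then show "f = g" ..
    qed
    show "(\<lambda>f. map f xs) ` ?S = ?L"
    proof
      show "(\<lambda>f. map f xs) ` ?S \<subseteq> ?L"
        using xs len by (auto simp: sum_list_distinct_conv_sum_set)
      show "?L \<subseteq> (\<lambda>f. map f xs) ` ?S"
      proof
        fix l assume l: "l \<in> ?L"
        define f where "f a = (case map_of (zip xs l) a of None \<Rightarrow> 0 | Some k \<Rightarrow> k)" for a
        have m: "map f xs = l"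
        proof (rule nth_equalityI)
          show "length (map f xs) = length l" using l len by simp
          fix i assume "i < length (map f xs)"
          then show "map f xs ! i = l ! i"
            using l len xs(2) by (simp add: f_def map_of_zip_nth)
        qed
        have "f a = 0" if "a \<notin> A" for a
        proof -
          have "map_of (zip xs l) a = None"
            using that xs(1) l len by (simp add: map_of_zip_is_None)
          then show ?thesis by (simp add: f_def)
        qed
        moreover have "sum f A = N"
          using sum_list_distinct_conv_sum_set[OF xs(2), of f] m l xs(1) by simp
        ultimately have "f \<in> ?S" by simp
        then show "l \<in> (\<lambda>f. map f xs) ` ?S" using m by force
      qed
    qed
  qed
  have pos: "0 < card A" using assms by (simp add: card_gt_0_iff)
  have cl: "card ?L = (N + card A - 1) choose N" by (rule card_length_sum_list)
  show "card ?S = (N + card A - 1) choose N"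
    using bij_betw_same_card[OF bij] cl by simp
  have "finite ?L"
  proof (rule finite_subset)
    show "?L \<subseteq> {l. set l \<subseteq> {..N} \<and> length l = card A}"
      by (auto dest: member_le_sum_list)
    show "finite {l. set l \<subseteq> {..N} \<and> length l = card A}" by (rule finite_lists_length_eq) simp
  qed
  then show "finite ?S" using bij_betw_finite[OF bij] by simp
qed

text \<open>
  For \<open>n \<ge> m + i\<close> both sides equal \<open>(n - i - 1)! / ((i - 1)! (m - i)! (n - m - i)!)\<close>; otherwise both
  sides vanish.
\<close>

lemma multinomial_two_factorizations:
  fixes n m i :: nat
  assumes "1 \<le> i" "i \<le> m" "m < n"
  shows "((n - m - 1) choose (i - 1)) * ((m - i + (n - m) - 1) choose (m - i)) =
         ((n - i - 1) choose (i - 1)) * ((n - 2 * i) choose (m - i))"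
proof (cases "n < m + i")
  case True
  have 1: "(n - m - 1) choose (i - 1) = 0" using True assms by (intro binomial_eq_0) linarith
  have 2: "(n - i - 1) choose (i - 1) = 0 \<or> (n - 2 * i) choose (m - i) = 0"
  proof (cases "n < 2 * i")
    case True
    then show ?thesis using assms by (intro disjI1 binomial_eq_0) linarith
  next
    case False
    then show ?thesis using \<open>n < m + i\<close> by (intro disjI2 binomial_eq_0) linarith
  qed
  then show ?thesis by (elim disjE) (simp_all only: 1 mult_zero_left mult_zero_right)
next
  case False
  define x y z where "x = i - 1" and "y = m - i" and "z = n - m - i"
  have n: "n = x + 1 + y + z + x + 1" "m = x + 1 + y" "i = x + 1"
    using assms False by (auto simp: x_def y_def z_def)
  have "((z + x) choose x) * ((y + (z + x)) choose y) = ((y + z + x) choose x) * ((y + z) choose y)"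
    using choose_mult_lemma[of z y x] binomial_symmetric[of x "z + x"]
      binomial_symmetric[of y "y + (z+x)"] binomial_symmetric[of x "y+z+x"]
      binomial_symmetric[of y "y+z"]
    by (simp add: algebra_simps)
  then show ?thesis using n by (simp add: algebra_simps)
qed

text \<open>
  To a tight forest \<open>F\<close> belong the spanning tree \<open>T F\<close> at the maximal point of its closed cell, the set
  \<open>R F\<close> of right ends of \<open>T F - F\<close>, and the right degrees \<open>g F\<close> of \<open>F\<close>, reduced by one.  The pair
  \<open>(R F, g F)\<close> determines \<open>F\<close>: each vertex of \<open>R F\<close> has lost exactly one edge, which fixes the right degrees
  of \<open>T F\<close> and hence \<open>T F\<close>, and the lost edge is the one coming from the parent.
\<close>

lemma generic_cell_count:
  fixes B :: "'n::finite set"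
  assumes gen: "generic B V" and B: "card B = m" and i: "1 \<le> i" "i \<le> m" "m < CARD('n)"
  defines "\<F> \<equiv> {F. \<exists>v. real_feasible B V v \<and> F = real_tight B V v \<and> no_isolated_vertex F \<and> dim (level_space F) = i}"
  shows "card \<F> \<le> ((CARD('n) - i - 1) choose (i - 1)) * ((CARD('n) - 2 * i) choose (m - i))"
proof -
  let ?n = "CARD('n)"
  have cB: "card (- B) = ?n - m" using card_Compl_add[of B] B by simp
  then obtain a0 where a0: "a0 \<notin> B"
    using i(3) by (metis ComplD card.empty ex_in_conv less_irrefl zero_less_diff)
  have "\<exists>v'. real_feasible B V v' \<and> F \<subseteq> real_tight B V v' \<and> spanning_connected (real_tight B V v') \<and>
       (\<forall>e\<in>real_tight B V v' - F. entering a0 (real_tight B V v') e)" if F: "F \<in> \<F>" for F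
  proof -
    obtain v where v: "real_feasible B V v" "F = real_tight B V v" "no_isolated_vertex F" using F unfolding \<F>_def by blast
    show ?thesis
      using maximal_point_tree[OF gen v(1) v(3)[unfolded v(2)] a0] unfolding v(2) by metis
  qed
  then obtain w where w: "\<And>F. F \<in> \<F> \<Longrightarrow> real_feasible B V (w F)" "\<And>F. F \<in> \<F> \<Longrightarrow> F \<subseteq> real_tight B V (w F)"
    "\<And>F. F \<in> \<F> \<Longrightarrow> spanning_connected (real_tight B V (w F))"
    "\<And>F e. F \<in> \<F> \<Longrightarrow> e \<in> real_tight B V (w F) - F \<Longrightarrow> entering a0 (real_tight B V (w F)) e"
    by metis
  define T where "T F = real_tight B V (w F)" for F
  have subT: "T F \<subseteq> B \<times> - B" for F unfolding T_def by (rule tight_edges_subset)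
  have forT: "forest (T F)" for F unfolding T_def using gen by (rule forest_tight)
  define R where "R F = snd ` (T F - F)" for F
  \<comment> \<open>Every right vertex has degree at least one, so the truncated subtraction loses nothing.\<close>
  define g where "g F a = (if a \<in> - B then right_degree F a - 1 else 0)" for F a
  have subF: "F \<subseteq> B \<times> - B" if "F \<in> \<F>" for F using w(2)[OF that] subT[of F] by (auto simp: T_def)
  have cardF: "card F + i = ?n" if "F \<in> \<F>" for F
    using forest_card[OF subF[OF that] forest_subset[OF forT[of F]]] w(2)[OF that] that
    by (auto simp: T_def \<F>_def)
  have inj_snd: "inj_on snd (T F - F)" if "F \<in> \<F>" for F
    unfolding T_def by (rule inj_onI) (use entering_unique w(3,4) that in blast)
  have cardR: "card (R F) = i - 1" if "F \<in> \<F>" for F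
  proof -
    have "card (T F) + 1 = ?n"
      using spanning_tree_card[OF subT forT] w(3)[OF that] by (simp add: T_def)
    moreover have "card (T F - F) = card (T F) - card F"
      using w(2)[OF that] by (intro card_Diff_subset) (auto simp: T_def)
    ultimately show ?thesis
      using cardF[OF that] i by (simp add: R_def card_image[OF inj_snd[OF that]])
  qed
  have subR: "R F \<subseteq> - B - {a0}" if "F \<in> \<F>" for F
  proof
    fix a assume "a \<in> R F"
    then obtain e where e: "e \<in> T F - F" "a = snd e" by (auto simp: R_def)
    then have "entering a0 (T F) e" using w(4)[OF that] by (simp add: T_def)
    then have "a \<noteq> a0" using e(2) by (auto simp: entering_def)
    then show "a \<in> - B - {a0}" using e subT[of F] by auto
  qed
  have deg_pos: "1 \<le> right_degree F a" if "F \<in> \<F>" "a \<notin> B" for F a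
  proof -
    have "a \<in> fst ` F \<union> snd ` F" using that(1) by (auto simp: \<F>_def no_isolated_vertex_def)
    then have "a \<in> snd ` F" using subF[OF that(1)] that(2) by auto
    then have "{e \<in> F. snd e = a} \<noteq> {}" by auto
    then have "0 < card {e \<in> F. snd e = a}" by (simp add: card_gt_0_iff)
    then show ?thesis unfolding right_degree_def by linarith
  qed
  have sum_g: "sum (g F) (- B) = m - i" if "F \<in> \<F>" for F
  proof -
    have "sum (g F) (- B) + card (- B) = (\<Sum>a\<in>-B. g F a + 1)"
      by (simp only: sum.distrib) simp
    also have "\<dots> = (\<Sum>a\<in>-B. right_degree F a)"
    proof (rule sum.cong)
      fix a assume "a \<in> - B"
      then show "g F a + 1 = right_degree F a" using deg_pos[OF that, of a] by (simp add: g_def)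
    qed simp
    also have "\<dots> = card F"
      unfolding sum_right_degree using subF[OF that] by (intro arg_cong[where f = card]) auto
    finally show ?thesis using cardF[OF that] cB i by linarith
  qed
  have degT: "right_degree (T F) a = right_degree F a + (if a \<in> R F then 1 else 0)"
    if "F \<in> \<F>" for F a
  proof -
    have "{e \<in> T F. snd e = a} = {e \<in> F. snd e = a} \<union> {e \<in> T F - F. snd e = a}"
      using w(2)[OF that] by (auto simp: T_def)
    then have "right_degree (T F) a = right_degree F a + card {e \<in> T F - F. snd e = a}"
      unfolding right_degree_def by (simp, subst card_Un_disjoint) auto
    moreover have "card {e \<in> T F - F. snd e = a} = (if a \<in> R F then 1 else 0)"
    proof (cases "a \<in> R F")
      case True
      then obtain e where "e \<in> T F - F" "snd e = a" by (auto simp: R_def)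
      then have "{e \<in> T F - F. snd e = a} = {e}"
        using inj_snd[OF that] by (auto simp: inj_on_def)
      then show ?thesis using True by simp
    next
      case False
      then have "{e \<in> T F - F. snd e = a} = {}" unfolding R_def by force
      then have "card {e \<in> T F - F. snd e = a} = 0" by (simp only: card.empty)
      then show ?thesis using False by simp
    qed
    ultimately show ?thesis by simp
  qed
  have inj: "inj_on (\<lambda>F. (R F, g F)) \<F>"
  proof (rule inj_onI)
    fix F G assume F: "F \<in> \<F>" and G: "G \<in> \<F>" and eq: "(R F, g F) = (R G, g G)"
    have deg: "right_degree F a = right_degree G a" for a
    proof (cases "a \<in> B")
      case True
      then have "{e \<in> F. snd e = a} = {}" "{e \<in> G. snd e = a} = {}"
        using subF[OF F] subF[OF G] by auto
      then show ?thesis by (simp only: right_degree_def)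
    next
      case False
      have "g F a = g G a" using eq by simp
      then show ?thesis using False deg_pos[OF F False] deg_pos[OF G False] by (simp add: g_def)
    qed
    have TT: "T F = T G" unfolding T_def
      by (rule tight_tree_unique[OF gen w(1)[OF F] w(1)[OF G] w(3)[OF F] w(3)[OF G]])
         (use degT[OF F] degT[OF G] deg eq in \<open>simp add: T_def\<close>)
    have sub: "T F - F \<subseteq> T G - G"
      if F: "F \<in> \<F>" and G: "G \<in> \<F>" and RR: "R F = R G" and TT: "T F = T G" for F G
    proof
      fix e assume e: "e \<in> T F - F"
      then have "snd e \<in> R G" using RR by (auto simp: R_def)
      then obtain d where d: "d \<in> T G - G" "snd e = snd d" by (auto simp: R_def)
      have "entering a0 (T F) e" "entering a0 (T F) d"
        using w(4)[OF F] w(4)[OF G] e d TT by (auto simp: T_def)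
      then have "e = d" using entering_unique[of "T F" a0 e d] d(2) w(3)[OF F] by (simp add: T_def)
      then show "e \<in> T G - G" using d by simp
    qed
    have "T F - F = T G - G"
      using sub[OF F G _ TT] sub[OF G F _ TT[symmetric]] eq by auto
    then show "F = G" using w(2)[OF F] w(2)[OF G] TT unfolding T_def by blast
  qed
  let ?Rs = "{S. S \<subseteq> - B - {a0} \<and> card S = i - 1}"
  let ?gs = "{f. (\<forall>a. a \<notin> - B \<longrightarrow> f a = (0::nat)) \<and> sum f (- B) = m - i}"
  have neB: "- B \<noteq> {}" using a0 by auto
  have "(\<lambda>F. (R F, g F)) ` \<F> \<subseteq> ?Rs \<times> ?gs"
    using subR cardR sum_g by (auto simp: g_def)
  moreover have "finite (?Rs \<times> ?gs)"
    using card_weak_compositions(1)[OF finite neB] by (intro finite_cartesian_product) auto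
  ultimately have "card \<F> \<le> card (?Rs \<times> ?gs)" by (rule card_inj_on_le[OF inj])
  also have "\<dots> = ((?n - m - 1) choose (i - 1)) * ((m - i + (?n - m) - 1) choose (m - i))"
    using card_weak_compositions(2)[OF finite neB, of "m - i"] a0 cB
    by (simp add: card_cartesian_product n_subsets)
  also have "\<dots> = ((?n - i - 1) choose (i - 1)) * ((?n - 2 * i) choose (m - i))"
    by (rule multinomial_two_factorizations[OF i])
  finally show ?thesis .
qed

section \<open>Perturbation to a generic matrix\<close>

text \<open>
  Among the points \<open>u\<close> satisfying the inequalities, take one whose tight edges have a level space of
  least dimension.  If this space were larger than that of \<open>G\<close>, it would contain a direction that
  increases across some edge of \<open>G\<close>; moving along it until an inequality becomes tight keeps all tight edges and
  makes the level space smaller.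
\<close>

lemma maximally_tight_point:
  fixes G :: "('n::finite \<times> 'n) set" and W :: "'n \<Rightarrow> 'n \<Rightarrow> real"
  assumes G: "G \<subseteq> B \<times> - B"
  obtains u :: "real ^ 'n" where "\<forall>e\<in>G. u $ snd e - u $ fst e \<le> W (fst e) (snd e)"
    "level_space {e \<in> G. u $ snd e - u $ fst e = W (fst e) (snd e)} = level_space G"
proof -
  define s where "s u e = W (fst e) (snd e) - (u $ snd e - u $ fst e)" for u :: "real ^ 'n" and e
  define Q where "Q u \<longleftrightarrow> (\<forall>e\<in>G. 0 \<le> s u e)" for u
  define F where "F u = {e \<in> G. s u e = 0}" for u
  define M where "M = (\<Sum>e\<in>G. \<bar>W (fst e) (snd e)\<bar>)"
  have "Q (\<chi> k. if k \<in> B then M else 0)" unfolding Q_def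
  proof
    fix e assume e: "e \<in> G"
    then have "\<bar>W (fst e) (snd e)\<bar> \<le> M" unfolding M_def
      by (intro member_le_sum[of e G "\<lambda>e. \<bar>W (fst e) (snd e)\<bar>"]) auto
    moreover have "fst e \<in> B" "snd e \<notin> B" using e G by auto
    ultimately show "0 \<le> s (\<chi> k. if k \<in> B then M else 0) e" by (simp add: s_def)
  qed
  then obtain u where u: "Q u" and min: "\<And>u'. Q u' \<Longrightarrow> dim (level_space (F u)) \<le> dim (level_space (F u'))"
    using exists_least_iff[of "\<lambda>d. \<exists>u. Q u \<and> dim (level_space (F u)) = d"]
    by (metis (mono_tags, lifting) not_le_imp_less)
  have FG: "F u \<subseteq> G" by (auto simp: F_def)
  have "level_space (F u) = level_space G"
  proof (rule ccontr)
    assume "level_space (F u) \<noteq> level_space G"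
    then obtain d where d: "d \<in> level_space (F u)" "d \<notin> level_space G"
      using level_space_mono[OF FG] by blast
    then obtain e0 where e0: "e0 \<in> G" "d $ fst e0 \<noteq> d $ snd e0" by (auto simp: level_space_def)
    define c where "c = (if d $ snd e0 > d $ fst e0 then d else - d)"
    have c: "c \<in> level_space (F u)"
      using d(1) by (auto simp: c_def subspace_neg[OF subspace_level_space])
    have c0: "c $ fst e0 < c $ snd e0" using e0(2) by (auto simp: c_def)
    define E where "E = {e \<in> G. c $ fst e < c $ snd e}"
    define r where "r e = s u e / (c $ snd e - c $ fst e)" for e
    \<comment> \<open>The first time at which an edge across which \<open>c\<close> increases becomes tight.\<close>
    define t where "t = Min (r ` E)"
    have E: "e0 \<in> E" using e0(1) c0 by (simp add: E_def)
    have "t \<in> r ` E" unfolding t_def using E by (intro Min_in) auto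
    then obtain e1 where e1: "e1 \<in> E" "r e1 = t" by auto
    have tmin: "t \<le> r e" if "e \<in> E" for e unfolding t_def using that by (intro Min_le) auto
    have t0: "0 \<le> t" using e1 u by (auto simp: r_def E_def Q_def)
    let ?u = "u + t *\<^sub>R c"
    have su: "s ?u e = s u e - t * (c $ snd e - c $ fst e)" for e
      by (simp add: s_def algebra_simps)
    have "Q ?u" unfolding Q_def su
    proof
      fix e assume e: "e \<in> G"
      show "0 \<le> s u e - t * (c $ snd e - c $ fst e)"
      proof (cases "e \<in> E")
        case True
        then have "t * (c $ snd e - c $ fst e) \<le> s u e"
          using tmin[OF True] by (simp add: r_def E_def pos_le_divide_eq)
        then show ?thesis by simp
      next
        case False
        then have "c $ snd e - c $ fst e \<le> 0" using e by (auto simp: E_def)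
        then have "t * (c $ snd e - c $ fst e) \<le> 0" using t0 by (simp add: mult_nonneg_nonpos)
        moreover have "0 \<le> s u e" using u e by (simp add: Q_def)
        ultimately show ?thesis by simp
      qed
    qed
    then have least: "dim (level_space (F u)) \<le> dim (level_space (F ?u))" by (rule min)
    have "F u \<subseteq> F ?u"
      using c by (auto simp: F_def su level_space_def)
    then have sub: "level_space (F ?u) \<subseteq> level_space (F u)" by (rule level_space_mono)
    have "e1 \<in> F ?u" using e1 by (auto simp: F_def su r_def E_def)
    moreover have "c $ fst e1 \<noteq> c $ snd e1" using e1(1) by (simp add: E_def)
    ultimately have "c \<notin> level_space (F ?u)" unfolding level_space_def by blast
    then have "level_space (F ?u) \<subset> level_space (F u)" using sub c by blast
    then have "dim (level_space (F ?u)) < dim (level_space (F u))"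
      by (metis dim_psubset span_eq_iff subspace_level_space)
    then show False using least by simp
  qed
  moreover have "F u = {e \<in> G. u $ snd e - u $ fst e = W (fst e) (snd e)}"
    by (auto simp: F_def s_def)
  moreover have "\<forall>e\<in>G. u $ snd e - u $ fst e \<le> W (fst e) (snd e)"
    using u by (auto simp: Q_def s_def)
  ultimately show ?thesis using that by simp
qed

text \<open>
  On the moment curve \<open>w = (x ^ f i)\<^sub>i\<close> every functional \<open>c j\<close> is a nonzero polynomial in \<open>x\<close>, so only
  finitely many \<open>x\<close> have to be avoided.
\<close>

lemma avoid_hyperplanes:
  fixes c :: "'j \<Rightarrow> 'i::finite \<Rightarrow> real"
  assumes "finite J" "\<And>j. j \<in> J \<Longrightarrow> c j \<noteq> (\<lambda>_. 0)"
  obtains w :: "'i \<Rightarrow> real" where "\<And>j. j \<in> J \<Longrightarrow> (\<Sum>i\<in>UNIV. c j i * w i) \<noteq> 0"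
proof -
  obtain f :: "'i \<Rightarrow> nat" where f: "inj f"
    using finite_imp_inj_to_nat_seg[OF finite[of "UNIV :: 'i set"]] by blast
  define P where "P j = (\<Sum>i\<in>UNIV. monom (c j i) (f i))" for j
  have "P j \<noteq> 0" if j: "j \<in> J" for j
  proof -
    obtain i where i: "c j i \<noteq> 0" using assms(2)[OF j] by (metis ext)
    have "coeff (P j) (f i) = (\<Sum>k\<in>UNIV. if k = i then c j k else 0)"
      unfolding P_def coeff_sum coeff_monom using f by (intro sum.cong) (auto simp: inj_eq)
    then show ?thesis using i by auto
  qed
  then have "finite (\<Union>j\<in>J. {x. poly (P j) x = 0})"
    using assms(1) by (auto intro: poly_roots_finite)
  then obtain x where x: "x \<notin> (\<Union>j\<in>J. {x. poly (P j) x = 0})"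
    using ex_new_if_finite infinite_UNIV_char_0 by blast
  show ?thesis
  proof (rule that)
    fix j assume "j \<in> J"
    then have "poly (P j) x \<noteq> 0" using x by blast
    then show "(\<Sum>i\<in>UNIV. c j i * x ^ f i) \<noteq> 0" by (simp add: P_def poly_sum poly_monom)
  qed
qed

text \<open>
  A linear dependency between the incidence vectors is a linear equation satisfied by every
  right-hand side \<open>V\<close> for which the system on \<open>D\<close> is solvable.
\<close>

lemma not_forest_relation:
  fixes D :: "('n::finite \<times> 'n) set"
  assumes "D \<subseteq> B \<times> - B" "\<not> forest D"
  shows "\<exists>c. c \<noteq> (\<lambda>_. 0) \<and>
    (\<forall>V (v :: real ^ 'n). (\<forall>e\<in>D. v $ snd e - v $ fst e = V e) \<longrightarrow> (\<Sum>e\<in>UNIV. c e * V e) = 0)"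
proof -
  obtain l where l: "(\<Sum>x\<in>edge_vector ` D. l x *\<^sub>R x) = 0" "\<exists>x\<in>edge_vector ` D. l x \<noteq> 0"
    using assms(2) dependent_finite[of "edge_vector ` D"] by (auto simp: forest_def)
  define c where "c e = (if e \<in> D then l (edge_vector e) else 0)" for e
  have "c \<noteq> (\<lambda>_. 0)" using l(2) by (auto simp: c_def fun_eq_iff)
  moreover have "(\<Sum>e\<in>UNIV. c e * V e) = 0"
    if V: "\<forall>e\<in>D. v $ snd e - v $ fst e = V e" for V and v :: "real ^ 'n"
  proof -
    have z: "(\<Sum>e\<in>D. c e *\<^sub>R edge_vector e) = 0"
      using l(1) inj_on_edge_vector[OF assms(1)] by (simp add: sum.reindex c_def)
    have "(\<Sum>e\<in>UNIV. c e * V e) = (\<Sum>e\<in>D. c e * V e)"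
      by (rule sum.mono_neutral_right) (auto simp: c_def)
    also have "\<dots> = v \<bullet> (\<Sum>e\<in>D. c e *\<^sub>R edge_vector e)"
      using V by (simp add: inner_sum_right inner_edge_vector)
    finally show ?thesis using z by simp
  qed
  ultimately show ?thesis by blast
qed

text \<open>
  The matrices that are not generic lie on finitely many hyperplanes through the origin.  If \<open>W\<close> lies on none of
  them, the line \<open>V + \<epsilon> W\<close> meets each of them at most once.
\<close>

lemma generic_direction:
  obtains W :: "'n::finite \<Rightarrow> 'n \<Rightarrow> real" where
    "\<And>V. \<forall>\<^sub>F \<epsilon> in at_right 0. generic B (\<lambda>b a. V b a + \<epsilon> * W b a)"
proof -
  let ?\<D> = "{D. D \<subseteq> B \<times> - B \<and> \<not> forest D}"
  have "\<exists>c. c \<noteq> (\<lambda>_. 0) \<and> (\<forall>V (v :: real ^ 'n). (\<forall>e\<in>D. v $ snd e - v $ fst e = V e) \<longrightarrow> (\<Sum>e\<in>UNIV. c e * V e) = 0)"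
    if "D \<in> ?\<D>" for D
    using not_forest_relation[of D B] that by simp
  then have "\<forall>D\<in>?\<D>. \<exists>c. c \<noteq> (\<lambda>_. 0) \<and>
      (\<forall>V (v :: real ^ 'n). (\<forall>e\<in>D. v $ snd e - v $ fst e = V e) \<longrightarrow> (\<Sum>e\<in>UNIV. c e * V e) = 0)"
    by blast
  from bchoice[OF this] obtain c where c': "\<forall>D\<in>?\<D>. c D \<noteq> (\<lambda>_. 0) \<and>
      (\<forall>V (v :: real ^ 'n). (\<forall>e\<in>D. v $ snd e - v $ fst e = V e) \<longrightarrow> (\<Sum>e\<in>UNIV. c D e * V e) = 0)"
    by blast
  then have c: "\<And>D. D \<in> ?\<D> \<Longrightarrow> c D \<noteq> (\<lambda>_. 0)"
    "\<And>D V (v :: real ^ 'n). D \<in> ?\<D> \<Longrightarrow> (\<forall>e\<in>D. v $ snd e - v $ fst e = V e) \<Longrightarrow> (\<Sum>e\<in>UNIV. c D e * V e) = 0"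
    by blast+
  obtain w :: "'n \<times> 'n \<Rightarrow> real" where w: "\<And>D. D \<in> ?\<D> \<Longrightarrow> (\<Sum>e\<in>UNIV. c D e * w e) \<noteq> 0"
  proof (rule avoid_hyperplanes[of ?\<D> c, OF finite c(1)])
    fix w assume "\<And>D. D \<in> ?\<D> \<Longrightarrow> (\<Sum>e\<in>UNIV. c D e * w e) \<noteq> 0"
    then show thesis by (rule that)
  qed
  show ?thesis
  proof (rule that[of "\<lambda>b a. w (b, a)"])
    fix V :: "'n \<Rightarrow> 'n \<Rightarrow> real"
    let ?p = "\<lambda>D. \<Sum>e\<in>UNIV. c D e * V (fst e) (snd e)"
    let ?q = "\<lambda>D. \<Sum>e\<in>UNIV. c D e * w e"
    have "\<forall>\<^sub>F \<epsilon> in at_right 0. \<forall>D\<in>?\<D>. ?p D + \<epsilon> * ?q D \<noteq> 0"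
    proof (rule eventually_ball_finite, simp, intro ballI)
      fix D assume D: "D \<in> ?\<D>"
      have "\<forall>\<^sub>F \<epsilon> in at_right 0. \<epsilon> \<noteq> - ?p D / ?q D"
      proof (cases "- ?p D / ?q D > 0")
        case True
        then show ?thesis
          using eventually_at_right_less[of 0] eventually_at_right_real[OF True]
          by (auto elim: eventually_mono)
      next
        case False
        then show ?thesis
          using eventually_at_right_less[of "0::real"] by (auto elim!: eventually_mono)
      qed
      then show "\<forall>\<^sub>F \<epsilon> in at_right 0. ?p D + \<epsilon> * ?q D \<noteq> 0"
        using w[OF D] by (auto elim!: eventually_mono simp: field_simps add_eq_0_iff)
    qed
    then show "\<forall>\<^sub>F \<epsilon> in at_right 0. generic B (\<lambda>b a. V b a + \<epsilon> * w (b, a))"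
    proof (rule eventually_mono)
      fix \<epsilon> assume ne: "\<forall>D\<in>?\<D>. ?p D + \<epsilon> * ?q D \<noteq> 0"
      show "generic B (\<lambda>b a. V b a + \<epsilon> * w (b, a))" unfolding generic_def
      proof (intro allI impI, rule ccontr)
        fix D v assume D: "D \<subseteq> B \<times> - B" "\<not> forest D"
          and eq: "\<forall>e\<in>D. v $ snd e - v $ fst e = V (fst e) (snd e) + \<epsilon> * w (fst e, snd e)"
        have "(\<Sum>e\<in>UNIV. c D e * (V (fst e) (snd e) + \<epsilon> * w (fst e, snd e))) = 0"
          by (rule c(2)[OF _ eq]) (use D in auto)
        then have "?p D + \<epsilon> * ?q D = 0"
          by (simp add: algebra_simps sum.distrib sum_distrib_left)
        then show False using ne D by auto
      qed
    qed
  qed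
qed

text \<open>
  The absence of isolated vertices depends on the level space alone, so it passes to subgraphs with the
  same components.
\<close>

lemma no_isolated_vertex_iff:
  fixes D :: "('n::finite \<times> 'n) set"
  assumes "D \<subseteq> B \<times> - B"
  shows "no_isolated_vertex D \<longleftrightarrow> (\<forall>k. axis k 1 \<notin> level_space D)"
proof -
  have "axis k 1 \<in> level_space D \<longleftrightarrow> k \<notin> fst ` D \<union> snd ` D" for k
    using assms by (force simp: level_space_def axis_def)
  then show ?thesis by (auto simp: no_isolated_vertex_def)
qed

text \<open>
  Each tight graph \<open>G\<close> comes with a point \<open>v G\<close>.  Replacing infinite entries by a number exceeding all
  differences of coordinates of these points leaves their tight graphs unchanged.  Move to the matrix
  \<open>V + \<epsilon> W\<close>, with \<open>W\<close> a generic direction, and to the point \<open>v G + \<epsilon> u G\<close>, where \<open>u G\<close> satisfies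
  the inequalities for \<open>W\<close> on \<open>G\<close> and has enough equalities to connect each component of \<open>G\<close>.  For small \<open>\<epsilon>\<close> the new
  tight graph is the forest \<open>F G \<subseteq> G\<close> of those equalities, and it has the same components as \<open>G\<close>.  No
  two graphs share a forest: if \<open>F G = F H\<close>, then \<open>v G\<close> and \<open>v H\<close> differ by a function constant on the
  common components, and then they have the same tight edges.
\<close>

lemma cell_count:
  fixes B :: "'n::finite set" and V :: "'n \<Rightarrow> 'n \<Rightarrow> ereal"
  assumes B: "card B = m" and i: "1 \<le> i" "i \<le> m" "m < CARD('n)"
    and Vm: "\<And>b a. b \<in> B \<Longrightarrow> a \<notin> B \<Longrightarrow> V b a \<noteq> -\<infinity>"
  defines "\<G> \<equiv> {G. \<exists>v. feasible B V v \<and> G = tight_edges B V v \<and> no_isolated_vertex G \<and> dim (level_space G) = i}"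
  shows "card \<G> \<le> ((CARD('n) - i - 1) choose (i - 1)) * ((CARD('n) - 2 * i) choose (m - i))"
proof -
  have "\<exists>v. feasible B V v \<and> tight_edges B V v = G" if "G \<in> \<G>" for G
    using that unfolding \<G>_def by blast
  then obtain v where v: "\<And>G. G \<in> \<G> \<Longrightarrow> feasible B V (v G)" "\<And>G. G \<in> \<G> \<Longrightarrow> tight_edges B V (v G) = G"
    by metis
  have subG: "G \<subseteq> B \<times> - B" if "G \<in> \<G>" for G using v(2)[OF that] tight_edges_subset by metis
  define M where "M = (\<Sum>G\<in>\<G>. \<Sum>k\<in>UNIV. 2 * \<bar>v G $ k\<bar>) + 1"
  have M: "v G $ a - v G $ b < M" if "G \<in> \<G>" for G a b
  proof -
    have "\<bar>v G $ k\<bar> \<le> (\<Sum>k\<in>UNIV. \<bar>v G $ k\<bar>)" for k by (rule member_le_sum) auto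
    from this[of a] this[of b] have "v G $ a - v G $ b \<le> (\<Sum>k\<in>UNIV. 2 * \<bar>v G $ k\<bar>)"
      by (simp add: sum_distrib_left[symmetric])
    also have "\<dots> \<le> (\<Sum>G\<in>\<G>. \<Sum>k\<in>UNIV. 2 * \<bar>v G $ k\<bar>)"
      by (rule member_le_sum[OF that, of "\<lambda>G. \<Sum>k\<in>UNIV. 2 * \<bar>v G $ k\<bar>"]) (auto intro: sum_nonneg)
    finally show ?thesis by (simp add: M_def)
  qed
  define V0 where "V0 b a = (if V b a = \<infinity> then M else real_of_ereal (V b a))" for b a
  have V0: "ereal (V0 b a) = V b a" if "b \<in> B" "a \<notin> B" "V b a \<noteq> \<infinity>" for b a
    using Vm[OF that(1,2)] that(3) by (cases "V b a") (auto simp: V0_def)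
  define s where "s G e = V0 (fst e) (snd e) - (v G $ snd e - v G $ fst e)" for G e
  have s0: "s G e = 0" if "G \<in> \<G>" "e \<in> G" for G e
  proof -
    have "ereal (v G $ snd e - v G $ fst e) = V (fst e) (snd e)" "fst e \<in> B" "snd e \<notin> B"
    proof -
      have "e \<in> tight_edges B V (v G)" using that v(2)[OF that(1)] by simp
      then show "ereal (v G $ snd e - v G $ fst e) = V (fst e) (snd e)" "fst e \<in> B" "snd e \<notin> B"
        by (auto simp: tight_edges_def)
    qed
    moreover from this(1) have "V (fst e) (snd e) \<noteq> \<infinity>" by (metis PInfty_neq_ereal(1))
    ultimately have "ereal (V0 (fst e) (snd e)) = ereal (v G $ snd e - v G $ fst e)"
      using V0[of "fst e" "snd e"] by metis
    then show ?thesis by (simp add: s_def)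
  qed
  have spos: "0 < s G e" if "G \<in> \<G>" "e \<in> B \<times> - B - G" for G e
  proof (cases "V (fst e) (snd e) = \<infinity>")
    case True
    then show ?thesis using M[OF that(1)] by (simp add: s_def V0_def)
  next
    case False
    have e: "fst e \<in> B" "snd e \<notin> B" using that by auto
    have "ereal (v G $ snd e - v G $ fst e) \<le> ereal (V0 (fst e) (snd e))"
      using v(1)[OF that(1)] e V0[OF e False] by (simp add: feasible_def)
    moreover have "ereal (v G $ snd e - v G $ fst e) \<noteq> ereal (V0 (fst e) (snd e))"
    proof -
      have "e \<notin> tight_edges B V (v G)" using that v(2)[OF that(1)] by simp
      then show ?thesis using that V0[OF e False] by (auto simp: tight_edges_def)
    qed
    ultimately show ?thesis by (simp add: s_def)
  qed
  obtain W :: "'n \<Rightarrow> 'n \<Rightarrow> real" where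
    W: "\<And>V. \<forall>\<^sub>F \<epsilon> in at_right 0. generic B (\<lambda>b a. V b a + \<epsilon> * W b a)"
    using generic_direction by blast
  have "\<exists>u :: real ^ 'n. (\<forall>e\<in>G. u $ snd e - u $ fst e \<le> W (fst e) (snd e)) \<and>
      level_space {e \<in> G. u $ snd e - u $ fst e = W (fst e) (snd e)} = level_space G"
    if G: "G \<in> \<G>" for G
  proof -
    obtain u :: "real ^ 'n" where "\<forall>e\<in>G. u $ snd e - u $ fst e \<le> W (fst e) (snd e)"
      "level_space {e \<in> G. u $ snd e - u $ fst e = W (fst e) (snd e)} = level_space G"
      by (rule maximally_tight_point[OF subG[OF G], of W])
    then show ?thesis by blast
  qed
  then have "\<forall>G\<in>\<G>. \<exists>u :: real ^ 'n. (\<forall>e\<in>G. u $ snd e - u $ fst e \<le> W (fst e) (snd e)) \<and>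
      level_space {e \<in> G. u $ snd e - u $ fst e = W (fst e) (snd e)} = level_space G"
    by blast
  from bchoice[OF this] obtain u where
    u': "\<forall>G\<in>\<G>. (\<forall>e\<in>G. u G $ snd e - u G $ fst e \<le> W (fst e) (snd e)) \<and>
      level_space {e \<in> G. u G $ snd e - u G $ fst e = W (fst e) (snd e)} = level_space G"
    by blast
  then have u: "\<And>G e. G \<in> \<G> \<Longrightarrow> e \<in> G \<Longrightarrow> u G $ snd e - u G $ fst e \<le> W (fst e) (snd e)"
    "\<And>G. G \<in> \<G> \<Longrightarrow>
      level_space {e \<in> G. u G $ snd e - u G $ fst e = W (fst e) (snd e)} = level_space G"
    by blast+
  define r where "r G e = W (fst e) (snd e) - (u G $ snd e - u G $ fst e)" for G e
  have "\<forall>\<^sub>F \<epsilon> in at_right 0. \<forall>x\<in>{(G, e). G \<in> \<G> \<and> e \<in> B \<times> - B - G}.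
      0 < s (fst x) (snd x) + \<epsilon> * r (fst x) (snd x)"
  proof (rule eventually_ball_finite)
    show "\<forall>x\<in>{(G, e). G \<in> \<G> \<and> e \<in> B \<times> - B - G}.
      \<forall>\<^sub>F \<epsilon> in at_right 0. 0 < s (fst x) (snd x) + \<epsilon> * r (fst x) (snd x)"
    proof safe
      fix G b a assume G: "G \<in> \<G>" and e: "b \<in> B" "a \<notin> B" "(b, a) \<notin> G"
      have "((\<lambda>\<epsilon>. s G (b, a) + \<epsilon> * r G (b, a)) \<longlongrightarrow> s G (b, a) + 0 * r G (b, a)) (at_right 0)"
        by (intro tendsto_intros)
      then have "\<forall>\<^sub>F \<epsilon> in at_right 0. 0 < s G (b, a) + \<epsilon> * r G (b, a)"
        using spos[OF G, of "(b, a)"] e by (intro order_tendstoD(1)) auto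
      then show "\<forall>\<^sub>F \<epsilon> in at_right 0. 0 < s (fst (G, b, a)) (snd (G, b, a)) +
          \<epsilon> * r (fst (G, b, a)) (snd (G, b, a))" by simp
    qed
  qed simp
  then have "\<forall>\<^sub>F \<epsilon> in at_right 0. 0 < \<epsilon> \<and> generic B (\<lambda>b a. V0 b a + \<epsilon> * W b a) \<and>
      (\<forall>x\<in>{(G, e). G \<in> \<G> \<and> e \<in> B \<times> - B - G}. 0 < s (fst x) (snd x) + \<epsilon> * r (fst x) (snd x))"
    using W[of V0] eventually_at_right_less[of "0::real"] by (intro eventually_conj)
  from eventually_happens'[OF trivial_limit_at_right_real this]
  obtain \<epsilon> where \<epsilon>': "0 < \<epsilon> \<and> generic B (\<lambda>b a. V0 b a + \<epsilon> * W b a) \<and>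
      (\<forall>x\<in>{(G, e). G \<in> \<G> \<and> e \<in> B \<times> - B - G}. 0 < s (fst x) (snd x) + \<epsilon> * r (fst x) (snd x))"
    by blast
  then have \<epsilon>: "0 < \<epsilon>" "generic B (\<lambda>b a. V0 b a + \<epsilon> * W b a)"
    "\<And>G e. G \<in> \<G> \<Longrightarrow> e \<in> B \<times> - B - G \<Longrightarrow> 0 < s G e + \<epsilon> * r G e"
    by auto
  define V' where "V' b a = V0 b a + \<epsilon> * W b a" for b a
  define x where "x G = v G + \<epsilon> *\<^sub>R u G" for G
  define F where "F G = {e \<in> G. u G $ snd e - u G $ fst e = W (fst e) (snd e)}" for G
  \<comment> \<open>On \<open>G\<close> the old slack \<open>s\<close> vanishes and the first-order slack \<open>r\<close> decides; off \<open>G\<close> the old slack dominates.\<close>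
  have slack: "V' (fst e) (snd e) - (x G $ snd e - x G $ fst e) = s G e + \<epsilon> * r G e" for G e
    by (simp add: V'_def x_def s_def r_def algebra_simps)
  have r0: "0 \<le> r G e" if "G \<in> \<G>" "e \<in> G" for G e using u(1)[OF that] by (simp add: r_def)
  have feas: "real_feasible B V' (x G)" if "G \<in> \<G>" for G unfolding feasible_def
  proof (intro ballI)
    fix b a assume ba: "b \<in> B" "a \<in> - B"
    have "0 \<le> s G (b, a) + \<epsilon> * r G (b, a)"
      using s0[OF that, of "(b, a)"] r0[OF that, of "(b, a)"] \<epsilon>(1) \<epsilon>(3)[OF that, of "(b, a)"] ba
      by (cases "(b, a) \<in> G") auto
    then show "ereal (x G $ a - x G $ b) \<le> ereal (V' b a)" using slack[of "(b, a)" G] by simp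
  qed
  have tight: "real_tight B V' (x G) = F G" if "G \<in> \<G>" for G
  proof (intro set_eqI)
    fix e
    have "e \<in> real_tight B V' (x G) \<longleftrightarrow> e \<in> B \<times> - B \<and> s G e + \<epsilon> * r G e = 0"
      unfolding tight_iff using slack[of e G] by auto
    also have "\<dots> \<longleftrightarrow> e \<in> G \<and> r G e = 0"
      using s0[OF that, of e] \<epsilon>(1) \<epsilon>(3)[OF that, of e] subG[OF that] by (cases "e \<in> G") auto
    also have "\<dots> \<longleftrightarrow> e \<in> F G" by (auto simp: F_def r_def)
    finally show "e \<in> real_tight B V' (x G) \<longleftrightarrow> e \<in> F G" .
  qed
  have level: "level_space (F G) = level_space G" if "G \<in> \<G>" for G
    using u(2)[OF that] by (simp add: F_def)
  have subF: "F G \<subseteq> B \<times> - B" if "G \<in> \<G>" for G using subG[OF that] by (auto simp: F_def)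
  let ?\<F> = "{F. \<exists>v. real_feasible B V' v \<and> F = real_tight B V' v \<and> no_isolated_vertex F \<and> dim (level_space F) = i}"
  have im: "F ` \<G> \<subseteq> ?\<F>"
  proof safe
    fix G assume G: "G \<in> \<G>"
    then have "no_isolated_vertex G" "dim (level_space G) = i" by (auto simp: \<G>_def)
    then have "no_isolated_vertex (F G)" "dim (level_space (F G)) = i"
      using level[OF G] no_isolated_vertex_iff[OF subG[OF G]] no_isolated_vertex_iff[OF subF[OF G]] by auto
    then show "\<exists>v. real_feasible B V' v \<and> F G = real_tight B V' v \<and> no_isolated_vertex (F G) \<and> dim (level_space (F G)) = i"
      using feas[OF G] tight[OF G] by metis
  qed
  have sub: "H \<subseteq> G" if G: "G \<in> \<G>" and H: "H \<in> \<G>" and eq: "F G = F H" for G H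
  proof
    fix e assume e: "e \<in> H"
    have "v G - v H \<in> level_space (F G)" unfolding level_space_def
    proof (intro CollectI ballI)
      fix d assume "d \<in> F G"
      moreover have "d \<in> F H" using \<open>d \<in> F G\<close> unfolding eq .
      ultimately have "d \<in> G" "d \<in> H" unfolding F_def by simp_all
      then show "(v G - v H) $ fst d = (v G - v H) $ snd d"
        using s0[OF G, of d] s0[OF H, of d] by (simp add: s_def)
    qed
    then have "v G - v H \<in> level_space H" using level[OF H] eq by simp
    then have "s G e = s H e" using e by (auto simp: level_space_def s_def algebra_simps)
    then have "s G e = 0" using s0[OF H e] by simp
    then show "e \<in> G" using spos[OF G, of e] subG[OF H] e by force
  qed
  have "inj_on F \<G>" by (rule inj_onI) (use sub in blast)
  then have "card \<G> \<le> card ?\<F>" using im by (intro card_inj_on_le) auto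
  also have "\<dots> \<le> ((CARD('n) - i - 1) choose (i - 1)) * ((CARD('n) - 2 * i) choose (m - i))"
    by (rule generic_cell_count[OF _ B i]) (use \<epsilon>(2) in \<open>simp add: V'_def[abs_def]\<close>)
  finally show ?thesis .
qed

section \<open>Initial matroids of tropical minors\<close>

text \<open>
  The matchings \<open>\<sigma>\<close> of the tropical minors, inverted: \<open>f b\<close> is the column assigned to the row \<open>b\<close>, so
  that matchings with different column sets are functions on the same domain.
\<close>

definition row_matching :: "'n::finite set \<Rightarrow> ('n \<Rightarrow> 'n \<Rightarrow> ereal) \<Rightarrow> ('n \<Rightarrow> 'n) \<Rightarrow> bool" where
  "row_matching B V f \<longleftrightarrow> inj_on f B \<and> (\<forall>b\<in>B. augmented_matrix B V b (f b) \<noteq> \<infinity>)"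

definition matching_cost :: "'n::finite set \<Rightarrow> ('n \<Rightarrow> 'n \<Rightarrow> ereal) \<Rightarrow> real ^ 'n \<Rightarrow> ('n \<Rightarrow> 'n) \<Rightarrow> real" where
  "matching_cost B V v f = (\<Sum>b\<in>B. real_of_ereal (augmented_matrix B V b (f b)) - v $ f b)"

definition optimal_matching :: "'n::finite set \<Rightarrow> ('n \<Rightarrow> 'n \<Rightarrow> ereal) \<Rightarrow> real ^ 'n \<Rightarrow> ('n \<Rightarrow> 'n) \<Rightarrow> bool" where
  "optimal_matching B V v f \<longleftrightarrow> row_matching B V f \<and>
     (\<forall>g. row_matching B V g \<longrightarrow> matching_cost B V v f \<le> matching_cost B V v g)"

lemma augmented_not_MInf:
  assumes "\<forall>b\<in>B. \<forall>a\<in>-B. V b a \<noteq> -\<infinity>" "b \<in> B"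
  shows "augmented_matrix B V b a \<noteq> -\<infinity>"
  using assms by (auto simp: augmented_matrix_def)

lemma sum_ereal_rows:
  assumes V: "\<forall>b\<in>B. \<forall>a\<in>-B. V b a \<noteq> -\<infinity>" and f: "row_matching B V f"
  shows "(\<Sum>b\<in>B. augmented_matrix B V b (f b)) =
         ereal (\<Sum>b\<in>B. real_of_ereal (augmented_matrix B V b (f b)))"
proof -
  have "(\<Sum>b\<in>B. augmented_matrix B V b (f b)) =
        (\<Sum>b\<in>B. ereal (real_of_ereal (augmented_matrix B V b (f b))))"
    using f augmented_not_MInf[OF V] by (intro sum.cong) (auto simp: row_matching_def ereal_real)
  then show ?thesis by simp
qed

lemma tropical_minors_le:
  assumes V: "\<forall>b\<in>B. \<forall>a\<in>-B. V b a \<noteq> -\<infinity>" and f: "row_matching B V f"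
  shows "tropical_minors B V (f ` B) \<le> ereal (\<Sum>b\<in>B. real_of_ereal (augmented_matrix B V b (f b)))"
proof -
  have bij: "bij_betw f B (f ` B)" using f by (simp add: row_matching_def bij_betw_def)
  let ?s = "the_inv_into B f"
  have "bij_betw ?s (f ` B) B" by (rule bij_betw_the_inv_into[OF bij])
  then have "tropical_minors B V (f ` B) \<le> (\<Sum>a\<in>f ` B. augmented_matrix B V (?s a) a)"
    unfolding tropical_minors_def by (intro INF_lower) simp
  also have "\<dots> = (\<Sum>b\<in>B. augmented_matrix B V b (f b))"
    using bij by (subst sum.reindex) (auto simp: bij_betw_def the_inv_into_f_f intro!: sum.cong)
  finally show ?thesis using sum_ereal_rows[OF V f] by simp
qed

lemma tropical_minors_attained:
  assumes V: "\<forall>b\<in>B. \<forall>a\<in>-B. V b a \<noteq> -\<infinity>" and fin: "tropical_minors B V A \<noteq> \<infinity>"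
  obtains f where "row_matching B V f" "f ` B = A"
    "tropical_minors B V A = ereal (\<Sum>b\<in>B. real_of_ereal (augmented_matrix B V b (f b)))"
proof -
  let ?S = "{\<sigma>. bij_betw \<sigma> A B}"
  let ?c = "\<lambda>\<sigma>. \<Sum>a\<in>A. augmented_matrix B V (\<sigma> a) a"
  have ne: "?S \<noteq> {}"
  proof
    assume "?S = {}"
    then have "tropical_minors B V A = \<infinity>" unfolding tropical_minors_def by (simp add: top_ereal_def)
    then show False using fin by simp
  qed
  have "?c ` ?S \<subseteq> range (\<lambda>\<sigma>. ?c \<sigma>)" by auto
  then have "finite (?c ` ?S)" by (rule finite_subset) simp
  then have "Inf (?c ` ?S) \<in> ?c ` ?S" using ne by (simp add: Min_Inf[symmetric])
  then obtain \<sigma> where s: "bij_betw \<sigma> A B" "tropical_minors B V A = ?c \<sigma>"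
    unfolding tropical_minors_def by auto
  define f where "f = the_inv_into A \<sigma>"
  have f: "bij_betw f B A" unfolding f_def using bij_betw_the_inv_into[OF s(1)] .
  have "?c \<sigma> = (\<Sum>b\<in>B. augmented_matrix B V (\<sigma> (f b)) (f b))"
    using sum.reindex_bij_betw[OF f, of "\<lambda>a. augmented_matrix B V (\<sigma> a) a"] by simp
  also have "\<dots> = (\<Sum>b\<in>B. augmented_matrix B V b (f b))"
    using s(1) by (intro sum.cong) (auto simp: f_def f_the_inv_into_f bij_betw_def)
  finally have eq: "tropical_minors B V A = (\<Sum>b\<in>B. augmented_matrix B V b (f b))" using s(2) by simp
  have "augmented_matrix B V b (f b) \<noteq> \<infinity>" if "b \<in> B" for b
    using fin eq that by (auto simp: sum_Pinfty)
  then have "row_matching B V f" using f by (auto simp: row_matching_def bij_betw_def)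
  then show ?thesis using that[of f] f eq sum_ereal_rows[OF V] by (simp add: bij_betw_def)
qed

lemma matching_cost_alt:
  assumes "row_matching B V f"
  shows "matching_cost B V v f =
    (\<Sum>b\<in>B. real_of_ereal (augmented_matrix B V b (f b))) - (\<Sum>a\<in>f ` B. v $ a)"
  using assms by (simp add: matching_cost_def sum_subtractf row_matching_def sum.reindex)

text \<open>
  A tropical minor is the least entry sum of a matching with the given columns; the coordinates of \<open>v\<close> only
  depend on the columns, so the bases of maximal weight are the column sets of the matchings of least cost.
\<close>

lemma initial_bases_tropical_minors:
  fixes B :: "'n::finite set"
  assumes V: "\<forall>b\<in>B. \<forall>a\<in>-B. V b a \<noteq> -\<infinity>" and B: "card B = m"
  shows "initial_bases m (tropical_minors B V) v = {f ` B | f. optimal_matching B V v f}"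
proof -
  let ?\<tau> = "tropical_minors B V" and ?\<M> = "matroid_bases m (tropical_minors B V)"
  have base: "f ` B \<in> ?\<M>" and le: "- matching_cost B V v f \<le> basis_weight ?\<tau> v (f ` B)"
    if f: "row_matching B V f" for f
  proof -
    have le1: "?\<tau> (f ` B) \<le> ereal (\<Sum>b\<in>B. real_of_ereal (augmented_matrix B V b (f b)))"
      by (rule tropical_minors_le[OF V f])
    then have fin: "?\<tau> (f ` B) \<noteq> \<infinity>" by auto
    then show "f ` B \<in> ?\<M>" using f B by (auto simp: matroid_bases_def row_matching_def card_image)
    obtain g where "?\<tau> (f ` B) = ereal (\<Sum>b\<in>B. real_of_ereal (augmented_matrix B V b (g b)))"
      using tropical_minors_attained[OF V fin] by metis
    then show "- matching_cost B V v f \<le> basis_weight ?\<tau> v (f ` B)"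
      using le1 matching_cost_alt[OF f] by (simp add: basis_weight_def)
  qed
  have att: "\<exists>f. row_matching B V f \<and> f ` B = A \<and> basis_weight ?\<tau> v A = - matching_cost B V v f"
    if "A \<in> ?\<M>" for A
  proof -
    have "?\<tau> A \<noteq> \<infinity>" using that by (simp add: matroid_bases_def)
    then obtain f where f: "row_matching B V f" "f ` B = A"
      "?\<tau> A = ereal (\<Sum>b\<in>B. real_of_ereal (augmented_matrix B V b (f b)))"
      using tropical_minors_attained[OF V] by metis
    then show ?thesis using matching_cost_alt[OF f(1), of v] by (intro exI[of _ f]) (simp add: basis_weight_def)
  qed
  show ?thesis
  proof (intro equalityI subsetI)
    fix A assume "A \<in> initial_bases m ?\<tau> v"
    then have A: "A \<in> ?\<M>" and max: "\<And>A'. A' \<in> ?\<M> \<Longrightarrow> basis_weight ?\<tau> v A' \<le> basis_weight ?\<tau> v A"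
      by (auto simp: initial_bases_def)
    obtain f where f: "row_matching B V f" "f ` B = A" "basis_weight ?\<tau> v A = - matching_cost B V v f"
      using att[OF A] by blast
    have "matching_cost B V v f \<le> matching_cost B V v g" if "row_matching B V g" for g
      using max[OF base[OF that]] le[OF that] f(3) by linarith
    then show "A \<in> {f ` B | f. optimal_matching B V v f}"
      using f by (auto simp: optimal_matching_def)
  next
    fix A assume "A \<in> {f ` B | f. optimal_matching B V v f}"
    then obtain f where f: "row_matching B V f" "A = f ` B"
      and opt: "\<And>g. row_matching B V g \<Longrightarrow> matching_cost B V v f \<le> matching_cost B V v g"
      by (auto simp: optimal_matching_def)
    have "basis_weight ?\<tau> v A' \<le> basis_weight ?\<tau> v A" if A': "A' \<in> ?\<M>" for A'
    proof -
      obtain g where "row_matching B V g" "basis_weight ?\<tau> v A' = - matching_cost B V v g"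
        using att[OF A'] by blast
      then show ?thesis using opt[of g] le[OF f(1)] f(2) by simp
    qed
    then show "A \<in> initial_bases m ?\<tau> v" using base[OF f(1)] f(2) by (simp add: initial_bases_def)
  qed
qed

text \<open>
  The rows on the alternating path of \<open>f\<close> and \<open>g\<close> that starts with the row to which \<open>f\<close> assigns \<open>a\<close>, passes from a
  row \<open>r\<close> to the row to which \<open>f\<close> assigns \<open>g r\<close>, and stops before reaching \<open>b\<close>.
\<close>

inductive_set exchange_rows :: "'n set \<Rightarrow> ('n \<Rightarrow> 'n) \<Rightarrow> ('n \<Rightarrow> 'n) \<Rightarrow> 'n \<Rightarrow> 'n \<Rightarrow> 'n set"
  for B f g b a where
  start: "r \<in> B \<Longrightarrow> r \<noteq> b \<Longrightarrow> f r = a \<Longrightarrow> r \<in> exchange_rows B f g b a"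
| step: "r \<in> exchange_rows B f g b a \<Longrightarrow> r' \<in> B \<Longrightarrow> r' \<noteq> b \<Longrightarrow> f r' = g r \<Longrightarrow>
    r' \<in> exchange_rows B f g b a"

text \<open>
  Let \<open>H\<close> be the set of exchange rows.  Changing \<open>f\<close> to \<open>g\<close> on \<open>H\<close> frees the column \<open>a\<close>, which can
  then be given to \<open>b\<close>.  Changing \<open>g\<close> to \<open>f\<close> on \<open>H\<close> also gives a matching, since \<open>a\<close> is not
  used by \<open>g\<close>.  Neither change lowers the cost; in the sum of the two inequalities the contributions of \<open>H\<close>
  cancel and the comparison of \<open>f b\<close> with \<open>a\<close> in row \<open>b\<close> remains.
\<close>

lemma optimal_row_minimal:
  fixes B :: "'n::finite set"
  assumes f: "optimal_matching B V v f" and g: "optimal_matching B V v g" and a: "a \<notin> g ` B"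
    and b: "b \<in> B" and fin: "augmented_matrix B V b a \<noteq> \<infinity>"
  shows "real_of_ereal (augmented_matrix B V b (f b)) - v $ f b \<le>
         real_of_ereal (augmented_matrix B V b a) - v $ a"
proof -
  define H where "H = exchange_rows B f g b a"
  define c where "c r k = real_of_ereal (augmented_matrix B V r k) - v $ k" for r k
  have HB: "r \<in> B \<and> r \<noteq> b" if "r \<in> H" for r
    using that unfolding H_def by (cases rule: exchange_rows.cases) auto
  have rf: "row_matching B V f" and rg: "row_matching B V g"
    using f g by (auto simp: optimal_matching_def)
  have injf: "inj_on f B" and injg: "inj_on g B" using rf rg by (auto simp: row_matching_def)
  define f' where "f' r = (if r = b then a else if r \<in> H then g r else f r)" for r
  define g' where "g' r = (if r \<in> H then f r else g r)" for r
  have "f' r \<noteq> f' r'" if r: "r \<in> B" "r' \<in> B" "r \<noteq> r'" for r r'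
  proof -
    have 1: "f' r \<noteq> f' r'" if "r \<in> B" "r \<noteq> b" "r' = b" for r r'
      using that a by (auto simp: f'_def H_def intro: exchange_rows.start)
    have 2: "f' r \<noteq> f' r'" if "r \<in> H" "r' \<in> B" "r' \<noteq> b" "r' \<notin> H" for r r'
      using that HB[OF that(1)] exchange_rows.step[of r B f g b a r'] by (auto simp: f'_def H_def)
    have 3: "f' r \<noteq> f' r'" if "r \<in> B" "r' \<in> B" "r \<noteq> r'" "r \<noteq> b" "r' \<noteq> b" "r \<in> H \<longleftrightarrow> r' \<in> H" for r r'
      using that injf injg by (auto simp: f'_def inj_on_def)
    show ?thesis using 1 2 3 r by metis
  qed
  then have "inj_on f' B" by (auto simp: inj_on_def)
  then have rf': "row_matching B V f'"
    using rf rg fin by (auto simp: row_matching_def f'_def)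
  have "g' r \<noteq> g' r'" if r: "r \<in> B" "r' \<in> B" "r \<noteq> r'" for r r'
  proof -
    have 1: "g' r \<noteq> g' r'" if H: "r \<in> H" and r': "r' \<in> B" "r' \<notin> H" for r r'
      using H[unfolded H_def]
    proof (cases rule: exchange_rows.cases)
      case start
      then show ?thesis using a H r' by (auto simp: g'_def)
    next
      case (step q)
      then have "q \<in> H" by (simp add: H_def)
      then have "g q \<noteq> g r'" using r' HB[of q] injg by (auto simp: inj_on_def)
      then show ?thesis using step H r' by (simp add: g'_def)
    qed
    have 2: "g' r \<noteq> g' r'" if "r \<in> B" "r' \<in> B" "r \<noteq> r'" "r \<in> H \<longleftrightarrow> r' \<in> H" for r r'
      using that injf injg by (auto simp: g'_def inj_on_def)
    show ?thesis using 1 2 r by metis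
  qed
  then have "inj_on g' B" by (auto simp: inj_on_def)
  then have rg': "row_matching B V g'"
    using rf rg by (auto simp: row_matching_def g'_def)
  have "H \<subseteq> B - {b}" using HB by auto
  then have split: "(\<Sum>r\<in>B. h r) = h b + (\<Sum>r\<in>H. h r) + (\<Sum>r\<in>B - {b} - H. h r)" for h :: "'n \<Rightarrow> real"
    using b by (simp add: sum.remove[of B b] sum.subset_diff[of H "B - {b}"])
  have C: "matching_cost B V v h = (\<Sum>r\<in>B. c r (h r))" for h
    by (simp add: matching_cost_def c_def)
  have bH: "b \<notin> H" using HB by blast
  have cf': "(\<Sum>r\<in>B. c r (f' r)) = c b a + (\<Sum>r\<in>H. c r (g r)) + (\<Sum>r\<in>B - {b} - H. c r (f r))"
    unfolding split using HB by (intro arg_cong2[where f = "(+)"] sum.cong) (auto simp: f'_def)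
  have cg': "(\<Sum>r\<in>B. c r (g' r)) = c b (g b) + (\<Sum>r\<in>H. c r (f r)) + (\<Sum>r\<in>B - {b} - H. c r (g r))"
    unfolding split using bH by (intro arg_cong2[where f = "(+)"] sum.cong) (auto simp: g'_def)
  have "(\<Sum>r\<in>B. c r (f r)) \<le> (\<Sum>r\<in>B. c r (f' r))"
    using f rf' by (simp add: optimal_matching_def C)
  moreover have "(\<Sum>r\<in>B. c r (g r)) \<le> (\<Sum>r\<in>B. c r (g' r))"
    using g rg' by (simp add: optimal_matching_def C)
  ultimately have "c b (f b) \<le> c b a"
    unfolding cf' cg' split[of "\<lambda>r. c r (f r)"] split[of "\<lambda>r. c r (g r)"] by linarith
  then show ?thesis by (simp add: c_def)
qed

text \<open>
  The case \<open>f b = b\<close> accounts for the zero diagonal of the tropical identity matrix, which is always tight.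
\<close>

definition transversals :: "'n set \<Rightarrow> ('n \<times> 'n) set \<Rightarrow> 'n set set" where
  "transversals B G = {f ` B | f. inj_on f B \<and> (\<forall>b\<in>B. f b = b \<or> (b, f b) \<in> G)}"

text \<open>
  As no column belongs to all optimal column sets, every optimal matching has least reduced cost in each
  row.  A column \<open>b \<in> B\<close> is used by some optimal matching, and only the row \<open>b\<close> has a finite entry there; hence the
  least reduced cost in row \<open>b\<close> is that of the diagonal entry, \<open>- v\<^sub>b\<close>.  So the optimal matchings
  are exactly those along diagonal entries and edges of \<open>G\<close>.  For the last equation, exchanging \<open>b\<close>
  for \<open>a\<close> in \<open>B\<close> along an edge of \<open>G\<close> gives a transversal, which forces \<open>u\<^sub>a = u\<^sub>b\<close>; conversely, if \<open>u\<close> is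
  constant on components, every transversal has the same sum as \<open>B\<close>, to which it is matched within
  the components.
\<close>

lemma initial_transversals:
  fixes B :: "'n::finite set"
  assumes V: "\<forall>b\<in>B. \<forall>a\<in>-B. V b a \<noteq> -\<infinity>" and B: "card B = m"
    and loopless: "\<Union> (initial_bases m (tropical_minors B V) v) = UNIV"
    and coloopless: "\<Inter> (initial_bases m (tropical_minors B V) v) = {}"
  defines "\<N> \<equiv> initial_bases m (tropical_minors B V) v" and "G \<equiv> tight_edges B V v"
  shows "feasible B V v" "no_isolated_vertex G" "\<N> = transversals B G" "sum_constant_space \<N> = level_space G"
proof -
  have N: "\<N> = {f ` B | f. optimal_matching B V v f}"
    unfolding \<N>_def by (rule initial_bases_tropical_minors[OF V B])
  have in_basis: "\<exists>A\<in>\<N>. k \<in> A" for k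
  proof -
    have "k \<in> \<Union>\<N>" using loopless by (simp add: \<N>_def)
    then show ?thesis by blast
  qed
  have avoids: "\<exists>A\<in>\<N>. k \<notin> A" for k
  proof -
    have "k \<notin> \<Inter>\<N>" using coloopless by (simp add: \<N>_def)
    then show ?thesis by blast
  qed
  define c where "c r k = real_of_ereal (augmented_matrix B V r k) - v $ k" for r k
  have rowmin: "c b (f b) \<le> c b a"
    if f: "optimal_matching B V v f" and b: "b \<in> B" and fin: "augmented_matrix B V b a \<noteq> \<infinity>" for f a b
  proof -
    obtain A where "A \<in> \<N>" "a \<notin> A" using avoids by blast
    then obtain g where "optimal_matching B V v g" "a \<notin> g ` B" unfolding N by auto
    then show ?thesis unfolding c_def by (intro optimal_row_minimal[OF f _ _ b fin])
  qed
  have fin_self: "augmented_matrix B V b b \<noteq> \<infinity>" and c_self: "c b b = - v $ b" if "b \<in> B" for b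
    using that by (auto simp: augmented_matrix_def c_def)
  have rowval: "c b (f b) = - v $ b" if f: "optimal_matching B V v f" and b: "b \<in> B" for f b
  proof (rule antisym)
    show "c b (f b) \<le> - v $ b" using rowmin[OF f b fin_self[OF b]] c_self[OF b] by simp
    obtain A where "A \<in> \<N>" "b \<in> A" using in_basis[of b] by blast
    then obtain h r where h: "optimal_matching B V v h" "r \<in> B" "b = h r" unfolding N by auto
    then have "augmented_matrix B V r b \<noteq> \<infinity>" by (auto simp: optimal_matching_def row_matching_def)
    then have "r = b" using b by (auto simp: augmented_matrix_def split: if_splits)
    then have "c b b \<le> c b (f b)"
      using rowmin[OF h(1) b, of "f b"] h(3) f b by (auto simp: optimal_matching_def row_matching_def)
    then show "- v $ b \<le> c b (f b)" using c_self[OF b] by simp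
  qed
  obtain f0 where f0: "optimal_matching B V v f0"
  proof -
    obtain A where "A \<in> \<N>" using in_basis by blast
    then show ?thesis using that unfolding N by auto
  qed
  have fin_V: "ereal (c b a + v $ a) = V b a" if "b \<in> B" "a \<notin> B" "V b a \<noteq> \<infinity>" for a b
  proof -
    have "V b a \<noteq> - \<infinity>" using V that by auto
    then show ?thesis using that by (cases "V b a") (auto simp: c_def augmented_matrix_def)
  qed
  have le: "- v $ b \<le> c b a" if "b \<in> B" "augmented_matrix B V b a \<noteq> \<infinity>" for a b
    using rowmin[OF f0 that] rowval[OF f0 that(1)] by simp
  show feas: "feasible B V v" unfolding feasible_def
  proof (intro ballI)
    fix b a assume ba: "b \<in> B" "a \<in> - B"
    show "ereal (v $ a - v $ b) \<le> V b a"
    proof (cases "V b a = \<infinity>")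
      case False
      then have "- v $ b \<le> c b a" using ba by (intro le) (auto simp: augmented_matrix_def)
      then have "ereal (v $ a - v $ b) \<le> ereal (c b a + v $ a)" by simp
      also have "\<dots> = V b a" using fin_V ba False by simp
      finally show ?thesis .
    qed simp
  qed
  have tightG: "(b, a) \<in> G \<longleftrightarrow> V b a \<noteq> \<infinity> \<and> c b a = - v $ b" if "b \<in> B" "a \<notin> B" for a b
  proof (cases "V b a = \<infinity>")
    case False
    then have "V b a = ereal (c b a + v $ a)" using fin_V[OF that] by simp
    then show ?thesis using that by (auto simp: G_def tight_edges_def)
  qed (auto simp: G_def tight_edges_def)
  have opt_iff: "optimal_matching B V v f \<longleftrightarrow> inj_on f B \<and> (\<forall>b\<in>B. f b = b \<or> (b, f b) \<in> G)" for f
  proof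
    assume f: "optimal_matching B V v f"
    then have rf: "row_matching B V f" by (simp add: optimal_matching_def)
    have "f b = b \<or> (b, f b) \<in> G" if b: "b \<in> B" for b
    proof (cases "f b \<in> B")
      case True
      then show ?thesis using rf b by (auto simp: row_matching_def augmented_matrix_def split: if_splits)
    next
      case False
      then have "V b (f b) \<noteq> \<infinity>" using rf b by (auto simp: row_matching_def augmented_matrix_def)
      then show ?thesis using tightG[OF b False] rowval[OF f b] by simp
    qed
    then show "inj_on f B \<and> (\<forall>b\<in>B. f b = b \<or> (b, f b) \<in> G)" using rf by (simp add: row_matching_def)
  next
    assume f: "inj_on f B \<and> (\<forall>b\<in>B. f b = b \<or> (b, f b) \<in> G)"
    have val: "c b (f b) = - v $ b \<and> augmented_matrix B V b (f b) \<noteq> \<infinity>" if b: "b \<in> B" for b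
    proof (cases "f b = b")
      case True
      then show ?thesis using c_self[OF b] fin_self[OF b] by simp
    next
      case False
      then have G: "(b, f b) \<in> G" using f b by auto
      then have "f b \<notin> B" by (auto simp: G_def tight_edges_def)
      then show ?thesis using tightG[OF b] G by (simp add: augmented_matrix_def)
    qed
    have "matching_cost B V v f \<le> matching_cost B V v g" if "row_matching B V g" for g
      unfolding matching_cost_def using that le val
      by (intro sum_mono) (simp add: c_def[symmetric] row_matching_def)
    then show "optimal_matching B V v f" using f val by (auto simp: optimal_matching_def row_matching_def)
  qed
  then show NT: "\<N> = transversals B G" by (simp add: N transversals_def)
  show "no_isolated_vertex G" unfolding no_isolated_vertex_def
  proof (intro equalityI subsetI UNIV_I)
    fix k :: 'n
    show "k \<in> fst ` G \<union> snd ` G"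
    proof (cases "k \<in> B")
      case True
      obtain A where "A \<in> \<N>" "k \<notin> A" using avoids by blast
      then obtain f where "\<forall>b\<in>B. f b = b \<or> (b, f b) \<in> G" "k \<notin> f ` B"
        unfolding NT transversals_def by auto
      then have "(k, f k) \<in> G" using True by (metis imageI)
      then show ?thesis by force
    next
      case False
      obtain A where "A \<in> \<N>" "k \<in> A" using in_basis[of k] by blast
      then obtain f b where "f b = b \<or> (b, f b) \<in> G" "b \<in> B" "k = f b"
        unfolding NT transversals_def by auto
      then have "(b, k) \<in> G" using False by auto
      then show ?thesis by force
    qed
  qed
  show "sum_constant_space \<N> = level_space G"
  proof (intro equalityI subsetI)
    fix u assume u: "u \<in> sum_constant_space \<N>"
    show "u \<in> level_space G" unfolding level_space_def
    proof safe
      fix b a assume G: "(b, a) \<in> G"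
      then have ba: "b \<in> B" "a \<notin> B" by (auto simp: G_def tight_edges_def)
      let ?f = "id(b := a)"
      have "inj_on ?f B" using ba by (auto simp: inj_on_def)
      moreover have "\<forall>r\<in>B. ?f r = r \<or> (r, ?f r) \<in> G" using G by auto
      ultimately have 1: "?f ` B \<in> \<N>" unfolding NT transversals_def by blast
      have "inj_on id B \<and> (\<forall>r\<in>B. id r = r \<or> (r, id r) \<in> G)" by simp
      then have "id ` B \<in> \<N>" unfolding NT transversals_def by blast
      then have 2: "B \<in> \<N>" by simp
      have "(\<Sum>k\<in>?f ` B. u $ k) = (\<Sum>k\<in>B. u $ k)"
        using u 1 2 unfolding sum_constant_space_def by blast
      moreover have "?f ` B = insert a (B - {b})" using ba by auto
      ultimately have "(\<Sum>k\<in>insert a (B - {b}). u $ k) = (\<Sum>k\<in>B. u $ k)" by (simp only:)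
      moreover have "(\<Sum>k\<in>B. u $ k) = u $ b + (\<Sum>k\<in>B - {b}. u $ k)"
        using ba(1) by (simp add: sum.remove)
      moreover have "(\<Sum>k\<in>insert a (B - {b}). u $ k) = u $ a + (\<Sum>k\<in>B - {b}. u $ k)"
        using ba(2) by (subst sum.insert) auto
      ultimately have "u $ a = u $ b" by linarith
      then show "u $ fst (b, a) = u $ snd (b, a)" by simp
    qed
  next
    fix u assume u: "u \<in> level_space G"
    have "(\<Sum>k\<in>A. u $ k) = (\<Sum>k\<in>B. u $ k)" if "A \<in> \<N>" for A
    proof -
      obtain f where f: "A = f ` B" "inj_on f B" "\<forall>b\<in>B. f b = b \<or> (b, f b) \<in> G"
        using \<open>A \<in> \<N>\<close> unfolding NT transversals_def by auto
      have "(\<Sum>k\<in>A. u $ k) = (\<Sum>b\<in>B. u $ f b)" using f by (simp add: sum.reindex)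
      also have "\<dots> = (\<Sum>b\<in>B. u $ b)"
      proof (rule sum.cong)
        fix b assume "b \<in> B"
        then have "f b = b \<or> (b, f b) \<in> G" using f(3) by blast
        then show "u $ f b = u $ b" using u by (force simp: level_space_def)
      qed simp
      finally show ?thesis .
    qed
    then show "u \<in> sum_constant_space \<N>" by (simp add: sum_constant_space_def)
  qed
qed

section \<open>The bound on the number of bounded faces\<close>

theorem theorem4p3:
  fixes p :: "'n::finite set \<Rightarrow> ereal" and m n :: nat
  assumes "n = CARD('n)" and "1 \<le> m" and "m < n"
    and "tropical_pluecker m p"
    and "conical m p"
  shows "\<forall>i. 1 \<le> i \<and> i \<le> m \<longrightarrow>
           finite (bounded_faces m p i) \<and>
           card (bounded_faces m p i) \<le> ((n - i - 1) choose (i - 1)) * ((n - 2 * i) choose (m - i))"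
proof (intro allI impI)
  fix i assume i: "1 \<le> i \<and> i \<le> m"
  note p = assms(4)
  obtain B V where B: "card B = m" and V: "\<forall>b\<in>B. \<forall>a\<in>-B. V b a \<noteq> -\<infinity>"
    and D: "regular_subdivision m p = regular_subdivision m (tropical_minors B V)"
    using assms(5) unfolding conical_def conical_subdivision_def by blast
  define \<G> where "\<G> = {G. \<exists>w. feasible B V w \<and> G = tight_edges B V w \<and> no_isolated_vertex G \<and>
    dim (level_space G) = i}"
  let ?face = "\<lambda>G. closure (open_cell m p (transversals B G))"
  have sub: "bounded_faces m p i \<subseteq> ?face ` \<G>"
  proof
    fix F assume F: "F \<in> bounded_faces m p i"
    then obtain v where v: "v \<in> real_part m p" and F_eq: "F = closure (open_cell m p (initial_bases m p v))"
      unfolding bounded_faces_def tls_faces_def open_cell_def by blast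
    define \<N> where "\<N> = initial_bases m p v"
    have cell: "v \<in> open_cell m p \<N>" using v by (simp add: open_cell_def \<N>_def)
    have F_cell: "F = closure (open_cell m p \<N>)" using F_eq by (simp add: \<N>_def)
    have dim: "dim (sum_constant_space \<N>) = i"
      using F aff_dim_open_cell[OF p cell] by (simp add: bounded_faces_def F_cell closure_aff_dim)
    have loopless: "\<Union> \<N> = UNIV" using v real_part_iff_loopless[OF p] by (simp add: \<N>_def)
    have coloopless: "\<Inter> \<N> = {}"
      by (rule bounded_cell_coloopless[OF p _ cell]) (use F assms(1-3) in \<open>auto simp: bounded_faces_def F_cell\<close>)
    have "matroid_polytope \<N> \<in> regular_subdivision m p"
      by (simp add: regular_subdivision_def \<N>_def)
    then have "matroid_polytope \<N> \<in> regular_subdivision m (tropical_minors B V)" by (simp only: D)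
    then obtain w where w: "matroid_polytope \<N> = matroid_polytope (initial_bases m (tropical_minors B V) w)"
      unfolding regular_subdivision_def by blast
    have card: "card A = m" if "A \<in> initial_bases m q x" for A q and x :: "real ^ 'n"
      using that by (simp add: initial_bases_def matroid_bases_def)
    have N: "\<N> = initial_bases m (tropical_minors B V) w"
    proof
      show "\<N> \<subseteq> initial_bases m (tropical_minors B V) w"
        by (rule matroid_polytope_subset[of _ m]) (use card w in \<open>auto simp: \<N>_def\<close>)
      show "initial_bases m (tropical_minors B V) w \<subseteq> \<N>"
        by (rule matroid_polytope_subset[of _ m]) (use card w in \<open>auto simp: \<N>_def\<close>)
    qed
    note G = initial_transversals[OF V B loopless[unfolded N] coloopless[unfolded N], folded N]
    have "tight_edges B V w \<in> \<G>" using G dim by (auto simp: \<G>_def)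
    moreover have "F = ?face (tight_edges B V w)" unfolding F_cell by (subst G(3)) (rule refl)
    ultimately show "F \<in> ?face ` \<G>" by blast
  qed
  have "card \<G> \<le> ((n - i - 1) choose (i - 1)) * ((n - 2 * i) choose (m - i))"
    unfolding \<G>_def assms(1) by (rule cell_count[OF B]) (use i V assms(1,3) in auto)
  moreover have "card (bounded_faces m p i) \<le> card \<G>"
    using card_mono[OF _ sub] card_image_le[of \<G> ?face] by simp
  moreover have "finite (bounded_faces m p i)" by (rule finite_subset[OF sub]) simp
  ultimately show "finite (bounded_faces m p i) \<and>
      card (bounded_faces m p i) \<le> ((n - i - 1) choose (i - 1)) * ((n - 2 * i) choose (m - i))"
    by linarith
qed

end
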